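(* Let $0\le p<\infty$. Then $\mathbb{T}^H_p$ is a monothetic Polish group which is topologically isomorphic to $l^p/\mathbb{Z}_0^{\infty}$.
   Context: $\mathbb{T}=\{z\in\mathbb{C}:|z|=1\}$. For $0<p<\infty$, $\mathbb{T}^H_p:=\{(z_n)\in\mathbb{T}^{\infty}:\ \sum_{n=1}^\infty|1-z_n|^p<\infty\}$ with metric $d_p((z_n),(w_n))=\left(\sum_n|z_n-w_n|^p\right)^{\min(1,1/p)}$; for $p=0$, $\mathbb{T}^H_0:=\{(z_n)\in\mathbb{T}^\infty:\ z_n\to1\}$ with metric $d_0((z_n),(w_n))=\sup_n|z_n-w_n|$. The group operation is coordinatewise multiplication. For $0<p<\infty$, $l^p$ is the additive topological group of real sequences with $\sum|x_n|^p<\infty$, with metric $\left(\sum|x_n-y_n|^p\right)^{\min(1,1/p)}$, and by convention $l^0:=c_0$ is the space of real null sequences with the sup norm. $\mathbb{Z}_0^\infty$ is the (closed discrete) subgroup of finitely supported integer sequences, and $l^p/\mathbb{Z}_0^\infty$ carries the quotient topology. A topological group is monothetic if it has a dense cyclic subgroup. *)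

theory Defs
  imports "HOL-Analysis.Analysis" "HOL-Algebra.Coset" "HOL-Algebra.Generated_Groups"
begin

section \<open>Topological groups\<close>

definition topological_group :: "('a, 'b) monoid_scheme \<Rightarrow> 'a topology \<Rightarrow> bool" where
  "topological_group G X \<longleftrightarrow>
     group G \<and> topspace X = carrier G \<and>
     continuous_map (prod_topology X X) X (\<lambda>(x, y). x \<otimes>\<^bsub>G\<^esub> y) \<and>
     continuous_map X X (\<lambda>x. inv\<^bsub>G\<^esub> x)"

definition polish_group :: "('a, 'b) monoid_scheme \<Rightarrow> 'a topology \<Rightarrow> bool" where
  "polish_group G X \<longleftrightarrow>
     topological_group G X \<and> completely_metrizable_space X \<and> separable_space X"

definition monothetic_group :: "('a, 'b) monoid_scheme \<Rightarrow> 'a topology \<Rightarrow> bool" where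
  "monothetic_group G X \<longleftrightarrow>
     topological_group G X \<and> (\<exists>g \<in> carrier G. X closure_of (generate G {g}) = topspace X)"

definition topologically_isomorphic ::
  "('a, 'c) monoid_scheme \<Rightarrow> 'a topology \<Rightarrow> ('b, 'd) monoid_scheme \<Rightarrow> 'b topology \<Rightarrow> bool" where
  "topologically_isomorphic G X H Y \<longleftrightarrow> (\<exists>f. f \<in> iso G H \<and> homeomorphic_map X Y f)"

definition quotient_topology :: "'a topology \<Rightarrow> ('a \<Rightarrow> 'b) \<Rightarrow> 'b topology" where
  "quotient_topology X q =
     topology (\<lambda>U. U \<subseteq> q ` topspace X \<and> openin X {x \<in> topspace X. q x \<in> U})"

lemma openin_quotient_topology:
  "openin (quotient_topology X q) U \<longleftrightarrow>
     U \<subseteq> q ` topspace X \<and> openin X {x \<in> topspace X. q x \<in> U}"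
proof -
  let ?L = "\<lambda>U. U \<subseteq> q ` topspace X \<and> openin X {x \<in> topspace X. q x \<in> U}"
  have "istopology ?L"
    unfolding istopology_def
  proof (intro conjI allI impI)
    fix S T assume "?L S" "?L T"
    moreover have "{x \<in> topspace X. q x \<in> S \<inter> T} =
        {x \<in> topspace X. q x \<in> S} \<inter> {x \<in> topspace X. q x \<in> T}"
      by auto
    ultimately show "S \<inter> T \<subseteq> q ` topspace X" "openin X {x \<in> topspace X. q x \<in> S \<inter> T}"
      by auto
  next
    fix K assume K: "\<forall>S\<in>K. ?L S"
    then show "\<Union>K \<subseteq> q ` topspace X" by blast
    have "{x \<in> topspace X. q x \<in> \<Union>K} = \<Union>((\<lambda>S. {x \<in> topspace X. q x \<in> S}) ` K)"
      by auto
    with K show "openin X {x \<in> topspace X. q x \<in> \<Union>K}"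
      by auto
  qed
  then show ?thesis
    unfolding quotient_topology_def by (simp add: topology_inverse')
qed

lemma topspace_quotient_topology: "topspace (quotient_topology X q) = q ` topspace X"
proof -
  have "openin (quotient_topology X q) (q ` topspace X)"
    unfolding openin_quotient_topology by (auto simp: Collect_conj_eq Int_absorb2 subset_iff)
  then show ?thesis
    unfolding topspace_def[of "quotient_topology X q"] by (auto simp: openin_quotient_topology)
qed

lemma quotient_map_quotient_topology: "quotient_map X (quotient_topology X q) q"
  unfolding quotient_map_def by (auto simp: openin_quotient_topology topspace_quotient_topology)


section \<open>Metric spaces of sequences\<close>

definition seq_dist :: "real \<Rightarrow> (nat \<Rightarrow> 'a::metric_space) \<Rightarrow> (nat \<Rightarrow> 'a) \<Rightarrow> real" where
  "seq_dist p x y =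
     (if p = 0 then (SUP n. dist (x n) (y n))
      else (\<Sum>n. dist (x n) (y n) powr p) powr min 1 (1 / p))"

text \<open>
  The locale \<^locale>\<open>Metric_space\<close> requires nonnegativity on the whole type, whereas the supremum
  of an unbounded set of reals is unspecified. So the distance is set to 0 unless both arguments
  lie in the carrier; this does not affect the topology.
\<close>

definition seq_dist_on ::
  "(nat \<Rightarrow> 'a::metric_space) set \<Rightarrow> real \<Rightarrow> (nat \<Rightarrow> 'a) \<Rightarrow> (nat \<Rightarrow> 'a) \<Rightarrow> real" where
  "seq_dist_on M p x y = (if x \<in> M \<and> y \<in> M then seq_dist p x y else 0)"

definition seq_topology :: "(nat \<Rightarrow> 'a::metric_space) set \<Rightarrow> real \<Rightarrow> (nat \<Rightarrow> 'a) topology" where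
  "seq_topology M p = Metric_space.mtopology M (seq_dist_on M p)"


section \<open>The groups\<close>

definition TH :: "real \<Rightarrow> (nat \<Rightarrow> complex) set" where
  "TH p = {z. (\<forall>n. norm (z n) = 1) \<and>
              (if p = 0 then z \<longlonglongrightarrow> 1 else summable (\<lambda>n. norm (1 - z n) powr p))}"

definition TH_group :: "real \<Rightarrow> (nat \<Rightarrow> complex) monoid" where
  "TH_group p = \<lparr>carrier = TH p, monoid.mult = (\<lambda>z w n. z n * w n), one = (\<lambda>n. 1)\<rparr>"

abbreviation TH_topology :: "real \<Rightarrow> (nat \<Rightarrow> complex) topology" where
  "TH_topology p \<equiv> seq_topology (TH p) p"

definition lp :: "real \<Rightarrow> (nat \<Rightarrow> real) set" where
  "lp p = {x. if p = 0 then x \<longlonglongrightarrow> 0 else summable (\<lambda>n. \<bar>x n\<bar> powr p)}"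

definition lp_group :: "real \<Rightarrow> (nat \<Rightarrow> real) monoid" where
  "lp_group p = \<lparr>carrier = lp p, monoid.mult = (\<lambda>x y n. x n + y n), one = (\<lambda>n. 0)\<rparr>"

abbreviation lp_topology :: "real \<Rightarrow> (nat \<Rightarrow> real) topology" where
  "lp_topology p \<equiv> seq_topology (lp p) p"

definition Z0 :: "(nat \<Rightarrow> real) set" where
  "Z0 = {x. (\<forall>n. x n \<in> \<int>) \<and> finite {n. x n \<noteq> 0}}"

definition lp_mod_Z0_group :: "real \<Rightarrow> (nat \<Rightarrow> real) set monoid" where
  "lp_mod_Z0_group p = lp_group p Mod Z0"

definition lp_mod_Z0_topology :: "real \<Rightarrow> (nat \<Rightarrow> real) set topology" where
  "lp_mod_Z0_topology p = quotient_topology (lp_topology p) (\<lambda>x. Z0 #>\<^bsub>lp_group p\<^esub> x)"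


section \<open>The distances are metrics\<close>

lemma powr_add_le_sum:
  fixes a b p :: real
  assumes "a \<ge> 0" "b \<ge> 0" "0 < p" "p \<le> 1"
  shows "(a + b) powr p \<le> a powr p + b powr p"
proof (cases "a + b = 0")
  case True
  then show ?thesis by auto
next
  case False
  then have s: "a + b > 0" using assms by auto
  have *: "t \<le> t powr p" if "0 \<le> t" "t \<le> 1" for t :: real
    using that assms powr_mono'[of p 1 t] by (cases "t = 0") auto
  have "1 = a / (a + b) + b / (a + b)"
    using s by (simp add: add_divide_distrib[symmetric])
  also have "\<dots> \<le> (a / (a + b)) powr p + (b / (a + b)) powr p"
    using s assms by (intro add_mono *) auto
  also have "\<dots> = (a powr p + b powr p) / (a + b) powr p"
    using s assms by (simp add: powr_divide add_divide_distrib)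
  finally show ?thesis using s by (simp add: field_simps)
qed

lemma powr_convex_nonneg:
  fixes a b u v p :: real
  assumes "a \<ge> 0" "b \<ge> 0" "u \<ge> 0" "v \<ge> 0" "u + v = 1" "1 \<le> p"
  shows "(u * a + v * b) powr p \<le> u * a powr p + v * b powr p"
proof -
  have *: "(t * s) powr p \<le> t * s powr p" if "0 \<le> t" "t \<le> 1" "0 \<le> s" for t s :: real
    using that assms powr_mono'[of 1 p t]
    by (cases "t = 0") (auto simp: powr_mult intro!: mult_right_mono)
  consider "a = 0" | "b = 0" | "a > 0" "b > 0" using assms by force
  then show ?thesis
  proof cases
    case 1
    then show ?thesis using *[of v b] assms by auto
  next
    case 2
    then show ?thesis using *[of u a] assms by auto
  next
    case 3
    have v: "0 \<le> v" "v \<le> 1" and u: "1 - v = u" using assms by auto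
    have "((1 - v) *\<^sub>R a + v *\<^sub>R b) powr p \<le> (1 - v) * a powr p + v * b powr p"
      using 3 by (intro convex_onD[OF powr_convex[OF assms(6)] v]) auto
    then show ?thesis by (simp only: u real_scaleR_def)
  qed
qed

lemma summable_powr_add:
  fixes a b :: "nat \<Rightarrow> real"
  assumes "\<And>n. a n \<ge> 0" "\<And>n. b n \<ge> 0" "p > 0"
    and "summable (\<lambda>n. a n powr p)" "summable (\<lambda>n. b n powr p)"
  shows "summable (\<lambda>n. (a n + b n) powr p)"
proof (rule summable_comparison_test')
  show "summable (\<lambda>n. 2 powr p * (a n powr p + b n powr p))"
    using assms by (intro summable_mult summable_add)
  fix n :: nat
  have "(a n + b n) powr p \<le> (2 * max (a n) (b n)) powr p"
    using assms by (intro powr_mono2) (auto simp: add_nonneg_nonneg)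
  also have "\<dots> = 2 powr p * max (a n) (b n) powr p"
    by (rule powr_mult)
  also have "\<dots> \<le> 2 powr p * (a n powr p + b n powr p)"
    by (intro mult_left_mono) (auto simp: max_def)
  finally show "norm ((a n + b n) powr p) \<le> 2 powr p * (a n powr p + b n powr p)"
    by simp
qed

lemma minkowski_suminf:
  fixes a b :: "nat \<Rightarrow> real"
  assumes a: "\<And>n. a n \<ge> 0" and b: "\<And>n. b n \<ge> 0" and p: "p > 0"
    and sa: "summable (\<lambda>n. a n powr p)" and sb: "summable (\<lambda>n. b n powr p)"
  shows "(\<Sum>n. (a n + b n) powr p) powr min 1 (1 / p)
      \<le> (\<Sum>n. a n powr p) powr min 1 (1 / p) + (\<Sum>n. b n powr p) powr min 1 (1 / p)"
proof -
  have sab: "summable (\<lambda>n. (a n + b n) powr p)"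
    by (rule summable_powr_add[OF assms])
  define A where "A = (\<Sum>n. a n powr p)"
  define B where "B = (\<Sum>n. b n powr p)"
  have A0: "A \<ge> 0" and B0: "B \<ge> 0" unfolding A_def B_def using sa sb by (auto intro: suminf_nonneg)
  show ?thesis
  proof (cases "p \<le> 1")
    case True
    have "(\<Sum>n. (a n + b n) powr p) \<le> (\<Sum>n. a n powr p + b n powr p)"
      using sa sb sab a b p True by (intro suminf_le powr_add_le_sum summable_add) auto
    also have "\<dots> = A + B" unfolding A_def B_def using suminf_add[OF sa sb] by simp
    finally have le: "(\<Sum>n. (a n + b n) powr p) \<le> A + B" .
    have "0 \<le> (\<Sum>n. (a n + b n) powr p)" using sab by (auto intro: suminf_nonneg)
    moreover have "min 1 (1 / p) = 1" using True p by (auto simp: min_def)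
    ultimately show ?thesis using le A0 B0 by (simp add: A_def[symmetric] B_def[symmetric])
  next
    case False
    then have m: "min 1 (1 / p) = 1 / p" and p1: "p \<ge> 1" by (auto simp: min_def)
    consider "A = 0" | "B = 0" | "A > 0" "B > 0" using A0 B0 by force
    then show ?thesis
    proof cases
      case 1
      then have "a n = 0" for n
        using suminf_eq_zero_iff[OF sa] by (auto simp: A_def)
      then show ?thesis by simp
    next
      case 2
      then have "b n = 0" for n
        using suminf_eq_zero_iff[OF sb] by (auto simp: B_def)
      then show ?thesis by simp
    next
      case 3
      define \<alpha> where "\<alpha> = A powr (1 / p)"
      define \<beta> where "\<beta> = B powr (1 / p)"
      have pos: "\<alpha> > 0" "\<beta> > 0" using 3 by (auto simp: \<alpha>_def \<beta>_def)
      have pw: "\<alpha> powr p = A" "\<beta> powr p = B" using 3 p by (auto simp: \<alpha>_def \<beta>_def powr_powr)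
      define u where "u = \<alpha> / (\<alpha> + \<beta>)"
      define v where "v = \<beta> / (\<alpha> + \<beta>)"
      have uv: "u \<ge> 0" "v \<ge> 0" "u + v = 1" using pos
        by (auto simp: u_def v_def add_divide_distrib[symmetric])
      define c where "c = (\<alpha> + \<beta>) powr p"
      have le: "(a n + b n) powr p \<le> c * (u * (a n powr p / A) + v * (b n powr p / B))" for n
      proof -
        have "a n + b n = (\<alpha> + \<beta>) * (u * (a n / \<alpha>) + v * (b n / \<beta>))"
        proof -
          have "(\<alpha> + \<beta>) * (u * (a n / \<alpha>) + v * (b n / \<beta>))
              = ((\<alpha> + \<beta>) * u) * (a n / \<alpha>) + ((\<alpha> + \<beta>) * v) * (b n / \<beta>)"
            by (simp only: distrib_left mult.assoc)
          moreover have "(\<alpha> + \<beta>) * u = \<alpha>" "(\<alpha> + \<beta>) * v = \<beta>"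
            using pos by (auto simp: u_def v_def)
          ultimately show ?thesis using pos by simp
        qed
        then have "(a n + b n) powr p = c * (u * (a n / \<alpha>) + v * (b n / \<beta>)) powr p"
          unfolding c_def using pos uv a[of n] b[of n] by (simp add: powr_mult)
        also have "\<dots> \<le> c * (u * (a n / \<alpha>) powr p + v * (b n / \<beta>) powr p)"
          unfolding c_def using pos uv a b p1
          by (intro mult_left_mono powr_convex_nonneg) auto
        also have "\<dots> = c * (u * (a n powr p / A) + v * (b n powr p / B))"
          using pos a b by (simp add: powr_divide pw)
        finally show ?thesis .
      qed
      have sums: "(\<lambda>n. c * (u * (a n powr p / A) + v * (b n powr p / B))) sums
                    (c * (u * (A / A) + v * (B / B)))"
        using summable_sums[OF sa] summable_sums[OF sb]
        by (intro sums_mult sums_add sums_divide) (auto simp: A_def B_def)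
      have "(\<Sum>n. (a n + b n) powr p) \<le> c * (u * (A / A) + v * (B / B))"
        using suminf_le[OF le sab sums_summable[OF sums]] sums_unique[OF sums] by simp
      also have "\<dots> = c" using 3 uv by simp
      finally have "(\<Sum>n. (a n + b n) powr p) powr (1 / p) \<le> c powr (1 / p)"
        using sab p by (intro powr_mono2) (auto intro: suminf_nonneg)
      also have "\<dots> = \<alpha> + \<beta>" using pos p by (simp add: c_def powr_powr)
      finally show ?thesis by (simp add: m \<alpha>_def \<beta>_def A_def B_def)
    qed
  qed
qed

lemma Metric_space_seq_dist_on:
  fixes M :: "(nat \<Rightarrow> 'a::metric_space) set"
  assumes p: "p \<ge> 0"
    and bdd: "\<And>x y. p = 0 \<Longrightarrow> x \<in> M \<Longrightarrow> y \<in> M \<Longrightarrow> bdd_above (range (\<lambda>n. dist (x n) (y n)))"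
    and sm: "\<And>x y. p > 0 \<Longrightarrow> x \<in> M \<Longrightarrow> y \<in> M \<Longrightarrow> summable (\<lambda>n. dist (x n) (y n) powr p)"
  shows "Metric_space M (seq_dist_on M p)"
proof
  fix x y :: "nat \<Rightarrow> 'a"
  have *: "0 \<le> seq_dist p x y" if "x \<in> M" "y \<in> M"
  proof (cases "p = 0")
    case True
    then have "dist (x 0) (y 0) \<le> (SUP n. dist (x n) (y n))"
      using bdd that by (intro cSUP_upper) auto
    then show ?thesis using True by (simp add: seq_dist_def order_trans[OF zero_le_dist])
  qed (simp add: seq_dist_def)
  then show "0 \<le> seq_dist_on M p x y" by (simp add: seq_dist_on_def)
  show "seq_dist_on M p x y = seq_dist_on M p y x"
    by (simp add: seq_dist_on_def seq_dist_def dist_commute)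
next
  fix x y assume xy: "x \<in> M" "y \<in> M"
  show "seq_dist_on M p x y = 0 \<longleftrightarrow> x = y"
  proof
    assume "x = y"
    then show "seq_dist_on M p x y = 0" by (simp add: seq_dist_on_def seq_dist_def)
  next
    assume "seq_dist_on M p x y = 0"
    then have d: "seq_dist p x y = 0" using xy by (simp add: seq_dist_on_def)
    have "dist (x n) (y n) = 0" for n
    proof (cases "p = 0")
      case True
      then have "dist (x n) (y n) \<le> (SUP n. dist (x n) (y n))"
        using bdd xy by (intro cSUP_upper) auto
      then show ?thesis using True d by (simp add: seq_dist_def)
    next
      case False
      then have "(\<Sum>n. dist (x n) (y n) powr p) = 0" using d by (simp add: seq_dist_def)
      then show ?thesis using suminf_eq_zero_iff[OF sm] xy False p by auto
    qed
    then show "x = y" by (auto intro: ext)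
  qed
next
  fix x y z assume xyz: "x \<in> M" "y \<in> M" "z \<in> M"
  have "seq_dist p x z \<le> seq_dist p x y + seq_dist p y z"
  proof (cases "p = 0")
    case True
    have "(SUP n. dist (x n) (z n)) \<le> (SUP n. dist (x n) (y n)) + (SUP n. dist (y n) (z n))"
    proof (rule cSUP_least)
      fix n :: nat
      have "dist (x n) (z n) \<le> dist (x n) (y n) + dist (y n) (z n)" by (rule dist_triangle)
      also have "\<dots> \<le> (SUP n. dist (x n) (y n)) + (SUP n. dist (y n) (z n))"
        using bdd xyz True by (intro add_mono cSUP_upper) auto
      finally show "dist (x n) (z n) \<le> (SUP n. dist (x n) (y n)) + (SUP n. dist (y n) (z n))" .
    qed simp
    then show ?thesis using True by (simp add: seq_dist_def)
  next
    case False
    with p have p0: "p > 0" by simp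
    note s = sm[OF p0]
    have "(\<Sum>n. dist (x n) (z n) powr p) \<le> (\<Sum>n. (dist (x n) (y n) + dist (y n) (z n)) powr p)"
      using p0 xyz s by (intro suminf_le powr_mono2 summable_powr_add dist_triangle) auto
    then have "(\<Sum>n. dist (x n) (z n) powr p) powr min 1 (1 / p)
        \<le> (\<Sum>n. (dist (x n) (y n) + dist (y n) (z n)) powr p) powr min 1 (1 / p)"
      using p0 xyz s by (intro powr_mono2) (auto intro: suminf_nonneg)
    also have "\<dots> \<le> (\<Sum>n. dist (x n) (y n) powr p) powr min 1 (1 / p)
        + (\<Sum>n. dist (y n) (z n) powr p) powr min 1 (1 / p)"
      using p0 xyz s by (intro minkowski_suminf) auto
    finally show ?thesis using False by (simp add: seq_dist_def)
  qed
  then show "seq_dist_on M p x z \<le> seq_dist_on M p x y + seq_dist_on M p y z"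
    using xyz by (simp add: seq_dist_on_def)
qed

lemma summable_dist_powr:
  fixes x y :: "nat \<Rightarrow> 'a::metric_space"
  assumes "p > 0" "summable (\<lambda>n. dist c (x n) powr p)" "summable (\<lambda>n. dist c (y n) powr p)"
  shows "summable (\<lambda>n. dist (x n) (y n) powr p)"
proof (rule summable_comparison_test')
  show "summable (\<lambda>n. (dist c (x n) + dist c (y n)) powr p)"
    using assms by (intro summable_powr_add) auto
  show "norm (dist (x n) (y n) powr p) \<le> (dist c (x n) + dist c (y n)) powr p" for n
    using assms dist_triangle3[of "x n" "y n" c] by (auto intro!: powr_mono2)
qed

lemma bdd_above_dist:
  fixes x y :: "nat \<Rightarrow> 'a::metric_space"
  assumes "convergent x" "convergent y"
  shows "bdd_above (range (\<lambda>n. dist (x n) (y n)))"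
proof -
  obtain a b where "x \<longlonglongrightarrow> a" "y \<longlonglongrightarrow> b" using assms by (auto simp: convergent_def)
  then have "(\<lambda>n. dist (x n) (y n)) \<longlonglongrightarrow> dist a b" by (intro tendsto_dist)
  then have "bounded (range (\<lambda>n. dist (x n) (y n)))" by (rule convergent_imp_bounded)
  then show ?thesis by (rule bounded_imp_bdd_above)
qed

lemma Metric_space_TH:
  assumes "p \<ge> 0"
  shows "Metric_space (TH p) (seq_dist_on (TH p) p)"
proof (rule Metric_space_seq_dist_on[OF assms])
  fix x y assume "p = 0" "x \<in> TH p" "y \<in> TH p"
  then show "bdd_above (range (\<lambda>n. dist (x n) (y n)))"
    by (intro bdd_above_dist convergentI[of _ 1]) (simp_all add: TH_def)
next
  fix x y assume p: "p > 0" and xy: "x \<in> TH p" "y \<in> TH p"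
  show "summable (\<lambda>n. dist (x n) (y n) powr p)"
    by (rule summable_dist_powr[OF p, of 1]) (use p xy in \<open>auto simp: TH_def dist_norm\<close>)
qed

lemma Metric_space_lp:
  assumes "p \<ge> 0"
  shows "Metric_space (lp p) (seq_dist_on (lp p) p)"
proof (rule Metric_space_seq_dist_on[OF assms])
  fix x y assume "p = 0" "x \<in> lp p" "y \<in> lp p"
  then show "bdd_above (range (\<lambda>n. dist (x n) (y n)))"
    by (intro bdd_above_dist convergentI[of _ 0]) (simp_all add: lp_def)
next
  fix x y assume p: "p > 0" and xy: "x \<in> lp p" "y \<in> lp p"
  show "summable (\<lambda>n. dist (x n) (y n) powr p)"
    by (rule summable_dist_powr[OF p, of 0]) (use p xy in \<open>auto simp: lp_def dist_norm\<close>)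
qed


section \<open>The quotient is taken by a normal subgroup\<close>

lemma lp_add:
  assumes "p \<ge> 0" "x \<in> lp p" "y \<in> lp p"
  shows "(\<lambda>n. x n + y n) \<in> lp p"
proof (cases "p = 0")
  case True
  then show ?thesis using assms tendsto_add[of x 0 sequentially y 0] by (simp add: lp_def)
next
  case False
  with assms have p: "p > 0" by simp
  have "summable (\<lambda>n. dist (x n) (- y n) powr p)"
    by (rule summable_dist_powr[OF p, of 0]) (use assms False in \<open>auto simp: lp_def dist_norm\<close>)
  then show ?thesis using False by (simp add: lp_def dist_norm)
qed

lemma lp_uminus: "x \<in> lp p \<Longrightarrow> (\<lambda>n. - x n) \<in> lp p"
  using tendsto_minus[of x 0 sequentially] by (auto simp: lp_def split: if_splits)

lemma comm_group_lp_group: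
  assumes "p \<ge> 0"
  shows "comm_group (lp_group p)"
proof (rule comm_groupI)
  fix x assume "x \<in> carrier (lp_group p)"
  then show "\<exists>y\<in>carrier (lp_group p). y \<otimes>\<^bsub>lp_group p\<^esub> x = \<one>\<^bsub>lp_group p\<^esub>"
    by (intro bexI[of _ "\<lambda>n. - x n"]) (auto simp: lp_group_def lp_uminus)
qed (use assms in \<open>auto simp: lp_group_def lp_add algebra_simps, simp add: lp_def\<close>)

lemma Z0_subset_lp: "Z0 \<subseteq> lp p"
proof
  fix x assume "x \<in> Z0"
  then have fin: "finite {n. x n \<noteq> 0}" by (simp add: Z0_def)
  have "x \<longlonglongrightarrow> 0"
    using fin by (intro tendsto_eventually) (simp add: eventually_cofinite cofinite_eq_sequentially[symmetric])
  moreover have "summable (\<lambda>n. \<bar>x n\<bar> powr p)"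
    using fin by (intro summable_finite[of "{n. x n \<noteq> 0}"]) auto
  ultimately show "x \<in> lp p" by (simp add: lp_def)
qed

lemma normal_Z0:
  assumes "p \<ge> 0"
  shows "Z0 \<lhd> lp_group p"
proof -
  interpret comm_group "lp_group p" by (rule comm_group_lp_group[OF assms])
  have inv: "inv\<^bsub>lp_group p\<^esub> x = (\<lambda>n. - x n)" if "x \<in> lp p" for x
    using that by (intro inv_equality) (auto simp: lp_group_def lp_uminus)
  have "subgroup Z0 (lp_group p)"
  proof (rule subgroupI)
    show "Z0 \<subseteq> carrier (lp_group p)" using Z0_subset_lp by (simp add: lp_group_def)
    have "(\<lambda>n. 0) \<in> Z0" by (simp add: Z0_def)
    then show "Z0 \<noteq> {}" by blast
    show "inv\<^bsub>lp_group p\<^esub> x \<in> Z0" if "x \<in> Z0" for x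
      using that Z0_subset_lp by (subst inv) (auto simp: Z0_def)
    fix x y assume xy: "x \<in> Z0" "y \<in> Z0"
    have "finite {n. x n + y n \<noteq> 0}"
      by (rule finite_subset[of _ "{n. x n \<noteq> 0} \<union> {n. y n \<noteq> 0}"]) (use xy in \<open>auto simp: Z0_def\<close>)
    with xy show "x \<otimes>\<^bsub>lp_group p\<^esub> y \<in> Z0" by (simp add: Z0_def lp_group_def)
  qed
  then show ?thesis by (rule subgroup_imp_normal)
qed

end

theory Submission
  imports Defs
begin

text \<open>
  The metrics are governed by the norm-like functional \<open>seq_norm p\<close> of the sequence of coordinate
  distances. Since \<open>\<bar>z w - z w'\<bar> = \<bar>w - w'\<bar>\<close> on the circle, the metric of the torus group is
  invariant, which makes it a topological group.

  A generator comes from Baire's theorem: finitely supported points are dense, and if \<open>v\<close> and \<open>c\<close>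
  are two of them, choosing a \<open>k\<close>-th root of \<open>c n\<close> nearest to \<open>v n\<close> in each coordinate gives, for
  large \<open>k\<close>, a \<open>g\<close> close to \<open>v\<close> with \<open>g ^ k = c\<close>. So for each open set the points having a power
  in that set form a dense open set.

  The isomorphism is induced by \<open>x \<mapsto> (cis (2 \<pi> x n))\<close>. This homomorphism is Lipschitz, and any
  displacement of its value lifts, through the principal argument, to a displacement of \<open>x\<close> that is
  no larger; hence it is open and onto. Its kernel consists of integer sequences tending to 0.
\<close>

section \<open>Norms of sequences\<close>

text \<open>The distance to the zero sequence; for \<open>0 < p < 1\<close> it is not homogeneous.
  Both metrics, on real and on unimodular sequences, are this functional applied to the coordinate
  distances.\<close>

definition seq_norm :: "real \<Rightarrow> (nat \<Rightarrow> real) \<Rightarrow> real" where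
  "seq_norm p a = seq_dist p a (\<lambda>_. 0)"

lemma seq_norm_0: "seq_norm 0 a = (SUP n. \<bar>a n\<bar>)"
  by (simp add: seq_norm_def seq_dist_def)

lemma seq_norm_pos: "p > 0 \<Longrightarrow> seq_norm p a = (\<Sum>n. \<bar>a n\<bar> powr p) powr min 1 (1 / p)"
  by (simp add: seq_norm_def seq_dist_def)

lemma seq_dist_eq_seq_norm: "seq_dist p x y = seq_norm p (\<lambda>n. dist (x n) (y n))"
  by (simp add: seq_norm_def seq_dist_def)

lemma lp_0_iff: "a \<in> lp 0 \<longleftrightarrow> a \<longlonglongrightarrow> 0"
  by (simp add: lp_def)

lemma lp_pos_iff: "p > 0 \<Longrightarrow> a \<in> lp p \<longleftrightarrow> summable (\<lambda>n. \<bar>a n\<bar> powr p)"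
  by (simp add: lp_def)

text \<open>Membership depends only on the size of the coordinates; later membership proofs mostly
  proceed by such a domination.\<close>

lemma lp_mono:
  assumes p: "p \<ge> 0" and b: "b \<in> lp p" and le: "\<And>n. \<bar>a n\<bar> \<le> c * \<bar>b n\<bar>"
  shows "a \<in> lp p"
proof (cases "p = 0")
  case True
  have "(\<lambda>n. c * \<bar>b n\<bar>) \<longlonglongrightarrow> c * 0"
    using b True by (intro tendsto_mult tendsto_const tendsto_rabs_zero) (simp add: lp_0_iff)
  then have "a \<longlonglongrightarrow> 0"
    by (intro Lim_null_comparison[where f = a and g = "\<lambda>n. c * \<bar>b n\<bar>"]) (use le in auto)
  then show ?thesis using True by (simp add: lp_0_iff)
next
  case False
  with p have p: "p > 0" by simp
  have "summable (\<lambda>n. \<bar>a n\<bar> powr p)"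
  proof (rule summable_comparison_test')
    show "summable (\<lambda>n. \<bar>c\<bar> powr p * \<bar>b n\<bar> powr p)"
      using b p by (intro summable_mult) (simp add: lp_pos_iff)
    fix n :: nat
    have "\<bar>a n\<bar> \<le> \<bar>c\<bar> * \<bar>b n\<bar>"
      using le[of n] mult_right_mono[OF abs_ge_self[of c], of "\<bar>b n\<bar>"] by simp
    then have "\<bar>a n\<bar> powr p \<le> (\<bar>c\<bar> * \<bar>b n\<bar>) powr p"
      using p by (intro powr_mono2) auto
    then show "norm (\<bar>a n\<bar> powr p) \<le> \<bar>c\<bar> powr p * \<bar>b n\<bar> powr p"
      by (simp add: powr_mult)
  qed
  then show ?thesis using p by (simp add: lp_pos_iff)
qed

lemma lp_abs:
  assumes "p \<ge> 0" "a \<in> lp p"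
  shows "(\<lambda>n. \<bar>a n\<bar>) \<in> lp p"
  by (rule lp_mono[OF assms, of _ 1]) simp

lemma bdd_above_lp_0: "a \<in> lp 0 \<Longrightarrow> bdd_above (range (\<lambda>n. \<bar>a n\<bar>))"
  using bdd_above_dist[of a "\<lambda>_. 0"] by (simp add: lp_0_iff convergentI convergent_const)

lemma seq_norm_nonneg:
  assumes "p \<ge> 0" "a \<in> lp p"
  shows "seq_norm p a \<ge> 0"
proof (cases "p = 0")
  case True
  have "\<bar>a 0\<bar> \<le> seq_norm p a"
    unfolding True seq_norm_0 using assms True by (intro cSUP_upper bdd_above_lp_0) auto
  then show ?thesis by linarith
qed (use assms in \<open>auto simp: seq_norm_pos\<close>)

text \<open>For \<open>p = 0\<close> the exponent is 1, because \<open>1 / 0 = 0\<close>.\<close>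

lemma abs_le_seq_norm:
  assumes p: "p \<ge> 0" and a: "a \<in> lp p"
  shows "\<bar>a n\<bar> \<le> seq_norm p a powr max 1 (1 / p)"
proof (cases "p = 0")
  case True
  have "\<bar>a n\<bar> \<le> seq_norm p a"
    unfolding True seq_norm_0 using assms True by (intro cSUP_upper bdd_above_lp_0) auto
  then show ?thesis using True seq_norm_nonneg[OF assms] by simp
next
  case False
  with p have p: "p > 0" by simp
  define S where "S = (\<Sum>n. \<bar>a n\<bar> powr p)"
  have "(\<Sum>m\<in>{n}. \<bar>a m\<bar> powr p) \<le> S"
    unfolding S_def using a p by (intro sum_le_suminf) (auto simp: lp_pos_iff)
  then have "(\<bar>a n\<bar> powr p) powr (1 / p) \<le> S powr (1 / p)"
    using p by (intro powr_mono2) auto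
  moreover have "min 1 (1 / p) * max 1 (1 / p) = 1 / p" by (auto simp: min_def max_def)
  ultimately show ?thesis
    using p by (simp add: seq_norm_pos powr_powr flip: S_def)
qed

text \<open>Scaling by \<open>c\<close> multiplies the functional by \<open>c\<close> to the power
  \<open>min p 1\<close> when \<open>p > 0\<close>, and by \<open>c\<close> itself when
  \<open>p = 0\<close>. The hypothesis \<open>c \<ge> 1\<close> bounds that power by
  \<open>c\<close>.\<close>

lemma seq_norm_mono:
  assumes p: "p \<ge> 0" and b: "b \<in> lp p" and c: "c \<ge> 1" and le: "\<And>n. \<bar>a n\<bar> \<le> c * \<bar>b n\<bar>"
  shows "seq_norm p a \<le> c * seq_norm p b"
proof (cases "p = 0")
  case True
  have "\<bar>a n\<bar> \<le> c * seq_norm p b" for n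
  proof -
    have "\<bar>b n\<bar> \<le> seq_norm p b"
      unfolding True seq_norm_0 using b True by (intro cSUP_upper bdd_above_lp_0) auto
    then show ?thesis using le[of n] c mult_left_mono[of "\<bar>b n\<bar>" "seq_norm p b" c] by linarith
  qed
  then show ?thesis unfolding True seq_norm_0 by (intro cSUP_least) auto
next
  case False
  with p have p: "p > 0" by simp
  have sb: "summable (\<lambda>n. \<bar>b n\<bar> powr p)" using b p by (simp add: lp_pos_iff)
  have sa: "summable (\<lambda>n. \<bar>a n\<bar> powr p)"
    using lp_mono[OF less_imp_le[OF p] b le] p by (simp add: lp_pos_iff)
  define m where "m = min 1 (1 / p)"
  have "(\<Sum>n. \<bar>a n\<bar> powr p) \<le> (\<Sum>n. c powr p * \<bar>b n\<bar> powr p)"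
  proof (intro suminf_le sa summable_mult sb)
    fix n
    have "\<bar>a n\<bar> powr p \<le> (c * \<bar>b n\<bar>) powr p" using p le by (intro powr_mono2) auto
    then show "\<bar>a n\<bar> powr p \<le> c powr p * \<bar>b n\<bar> powr p" using c by (simp add: powr_mult)
  qed
  also have "\<dots> = c powr p * (\<Sum>n. \<bar>b n\<bar> powr p)" using suminf_mult[OF sb] .
  finally have "(\<Sum>n. \<bar>a n\<bar> powr p) powr m \<le> (c powr p * (\<Sum>n. \<bar>b n\<bar> powr p)) powr m"
    using sa p by (intro powr_mono2) (auto simp: m_def intro: suminf_nonneg)
  also have "\<dots> = c powr (p * m) * seq_norm p b"
    using sb c p by (simp add: powr_mult powr_powr seq_norm_pos m_def suminf_nonneg)
  also have "\<dots> \<le> c powr 1 * seq_norm p b"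
    using c p by (intro mult_right_mono powr_mono) (auto simp: m_def min_def seq_norm_pos divide_simps)
  finally show ?thesis using c p by (simp add: seq_norm_pos m_def)
qed

text \<open>Tails of null sequences have vanishing supremum, and tails of convergent series vanish.
  This lets finitely supported points approximate all others.\<close>

lemma seq_norm_tail:
  assumes p: "p \<ge> 0" and a: "a \<in> lp p"
  shows "(\<lambda>N. seq_norm p (\<lambda>n. if n < N then 0 else a n)) \<longlonglongrightarrow> 0"
proof (cases "p = 0")
  case True
  have lim: "a \<longlonglongrightarrow> 0" using a True by (simp add: lp_0_iff)
  show ?thesis
  proof (rule LIMSEQ_I)
    fix e :: real assume "e > 0"
    then obtain N0 where N0: "\<And>n. n \<ge> N0 \<Longrightarrow> \<bar>a n\<bar> < e / 2"
      using LIMSEQ_D[OF lim, of "e / 2"] by auto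
    show "\<exists>no. \<forall>N\<ge>no. norm (seq_norm p (\<lambda>n. if n < N then 0 else a n) - 0) < e"
    proof (intro exI allI impI)
      fix N assume "N \<ge> N0"
      then have "seq_norm p (\<lambda>n. if n < N then 0 else a n) \<le> e / 2"
        unfolding True seq_norm_0 using N0 \<open>e > 0\<close>
        by (intro cSUP_least) (auto intro!: less_imp_le)
      moreover have "seq_norm p (\<lambda>n. if n < N then 0 else a n) \<ge> 0"
        by (intro seq_norm_nonneg lp_mono[OF p a, of _ 1] p) auto
      ultimately show "norm (seq_norm p (\<lambda>n. if n < N then 0 else a n) - 0) < e"
        using \<open>e > 0\<close> by simp
    qed
  qed
next
  case False
  with p have p: "p > 0" by simp
  have s: "summable (\<lambda>n. \<bar>a n\<bar> powr p)" using a p by (simp add: lp_pos_iff)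
  have eq: "(\<Sum>n. \<bar>if n < N then 0 else a n\<bar> powr p)
      = (\<Sum>n. \<bar>a n\<bar> powr p) - (\<Sum>n<N. \<bar>a n\<bar> powr p)" for N
  proof -
    have "(\<lambda>n. \<bar>a n\<bar> powr p - (if n \<in> {..<N} then \<bar>a n\<bar> powr p else 0)) sums
        ((\<Sum>n. \<bar>a n\<bar> powr p) - (\<Sum>n<N. \<bar>a n\<bar> powr p))"
      by (intro sums_diff summable_sums s sums_If_finite_set) auto
    also have "(\<lambda>n. \<bar>a n\<bar> powr p - (if n \<in> {..<N} then \<bar>a n\<bar> powr p else 0)) =
        (\<lambda>n. \<bar>if n < N then 0 else a n\<bar> powr p)" by auto
    finally show ?thesis by (rule sums_unique[symmetric])
  qed
  have "(\<lambda>N. (\<Sum>n. \<bar>a n\<bar> powr p) - (\<Sum>n<N. \<bar>a n\<bar> powr p)) \<longlonglongrightarrow>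
      (\<Sum>n. \<bar>a n\<bar> powr p) - (\<Sum>n. \<bar>a n\<bar> powr p)"
    using s by (intro tendsto_diff tendsto_const summable_LIMSEQ)
  then have "(\<lambda>N. ((\<Sum>n. \<bar>a n\<bar> powr p) - (\<Sum>n<N. \<bar>a n\<bar> powr p)) powr min 1 (1 / p)) \<longlonglongrightarrow>
      0 powr min 1 (1 / p)"
    using p s by (intro tendsto_powr2 tendsto_const) (auto simp: sum_le_suminf)
  then show ?thesis using p by (simp add: seq_norm_pos eq)
qed

text \<open>With at most \<open>N\<close> nonzero coordinates the sum has at most \<open>N\<close>
  terms, so smallness of each coordinate suffices.\<close>

lemma seq_norm_finite_small:
  assumes p: "p \<ge> 0" and e: "e > 0"
  obtains \<delta> where "\<delta> > 0"
    and "\<And>a. (\<And>n. n < N \<Longrightarrow> \<bar>a n\<bar> < \<delta>) \<Longrightarrow> (\<And>n. n \<ge> N \<Longrightarrow> a n = 0) \<Longrightarrow> seq_norm p a < e"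
proof (cases "p = 0")
  case True
  have "seq_norm p a < e" if "\<And>n. n < N \<Longrightarrow> \<bar>a n\<bar> < e / 2" "\<And>n. n \<ge> N \<Longrightarrow> a n = 0" for a
  proof -
    have "\<bar>a n\<bar> \<le> e / 2" for n using that[of n] e by (cases "n < N") auto
    then have "seq_norm p a \<le> e / 2" unfolding True seq_norm_0 by (intro cSUP_least) auto
    then show ?thesis using e by linarith
  qed
  then show thesis using that[of "e / 2"] e by auto
next
  case False
  with p have p: "p > 0" by simp
  define m where "m = min 1 (1 / p)"
  have m: "m > 0" using p by (simp add: m_def)
  \<comment> \<open>Chosen so that \<open>(N + 1) * t powr p\<close> equals
    \<open>e powr (1 / m)\<close>. Taking \<open>N + 1\<close> instead of \<open>N\<close> covers
    \<open>N = 0\<close> and makes the bound strict.\<close>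
  define t where "t = (e powr (1 / m) / (real N + 1)) powr (1 / p)"
  have t0: "t > 0" using e by (simp add: t_def)
  have "t powr p = e powr (1 / m) / (real N + 1)"
    using p e by (simp add: t_def powr_powr)
  then have "e powr (1 / m) = (real N + 1) * t powr p" by simp
  also have "\<dots> > real N * t powr p" using t0 by (simp add: algebra_simps)
  finally have "real N * t powr p < e powr (1 / m)" .
  then have "(real N * t powr p) powr m < (e powr (1 / m)) powr m"
    using m by (intro powr_less_mono2) auto
  then have t: "(real N * t powr p) powr m < e" "t > 0"
    using e m t0 by (auto simp: powr_powr)
  show thesis
  proof (rule that[OF t(2)])
    fix a :: "nat \<Rightarrow> real" assume a: "\<And>n. n < N \<Longrightarrow> \<bar>a n\<bar> < t" "\<And>n. n \<ge> N \<Longrightarrow> a n = 0"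
    have "(\<Sum>n. \<bar>a n\<bar> powr p) = (\<Sum>n<N. \<bar>a n\<bar> powr p)"
      using a(2) by (intro suminf_finite) (auto simp: not_less)
    also have "\<dots> \<le> (\<Sum>n<N. t powr p)"
      using a(1) p by (intro sum_mono powr_mono2) (auto intro: less_imp_le)
    finally have "(\<Sum>n. \<bar>a n\<bar> powr p) \<le> real N * t powr p" by simp
    moreover have "(\<Sum>n. \<bar>a n\<bar> powr p) \<ge> 0"
      using a(2) by (intro suminf_nonneg summable_finite[of "{..<N}"]) (auto simp: not_less)
    ultimately have "(\<Sum>n. \<bar>a n\<bar> powr p) powr m \<le> (real N * t powr p) powr m"
      using m by (intro powr_mono2) auto
    then show "seq_norm p a < e" using t p by (simp add: seq_norm_pos m_def)
  qed
qed

text \<open>Fatou's lemma for counting measure: bounds on finitely many coordinates survive a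
  pointwise limit. Membership of the limit is claimed for \<open>p > 0\<close> alone because a
  bounded pointwise limit of null sequences can fail to be null.\<close>

lemma seq_norm_Fatou:
  assumes p: "p \<ge> 0" and a: "\<And>m. a m \<in> lp p"
    and le: "\<forall>\<^sub>F m in sequentially. seq_norm p (a m) \<le> e"
    and lim: "\<And>n. (\<lambda>m. a m n) \<longlonglongrightarrow> b n"
  shows "p > 0 \<Longrightarrow> b \<in> lp p" and "seq_norm p b \<le> e"
proof -
  have e0: "e \<ge> 0"
    using eventually_happens'[OF _ le] seq_norm_nonneg[OF p a] by (auto intro: order_trans)
  have pos: "b \<in> lp p \<and> seq_norm p b \<le> e" if p: "p > 0"
  proof -
    have s: "summable (\<lambda>n. \<bar>a m n\<bar> powr p)" for m using a p by (simp add: lp_pos_iff)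
    \<comment> \<open>The reciprocal of \<open>min 1 (1 / p)\<close>: it recovers the sum of powers
      from the functional.\<close>
    define M where "M = max 1 p"
    have M: "min 1 (1 / p) * M = 1" using p by (auto simp: M_def min_def max_def)
    have "\<forall>\<^sub>F m in sequentially. (\<Sum>n<L. \<bar>a m n\<bar> powr p) \<le> e powr M" for L
      using le
    proof eventually_elim
      fix m assume le: "seq_norm p (a m) \<le> e"
      have nn: "(\<Sum>n. \<bar>a m n\<bar> powr p) \<ge> 0" using s by (auto intro: suminf_nonneg)
      have "(\<Sum>n<L. \<bar>a m n\<bar> powr p) \<le> (\<Sum>n. \<bar>a m n\<bar> powr p)"
        using s by (intro sum_le_suminf) auto
      also have "\<dots> = seq_norm p (a m) powr M"
        using p nn by (simp add: seq_norm_pos powr_powr M)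
      also have "\<dots> \<le> e powr M"
        using le seq_norm_nonneg[OF less_imp_le[OF p] a] by (intro powr_mono2) (auto simp: M_def)
      finally show "(\<Sum>n<L. \<bar>a m n\<bar> powr p) \<le> e powr M" .
    qed
    moreover have "(\<lambda>m. \<Sum>n<L. \<bar>a m n\<bar> powr p) \<longlonglongrightarrow> (\<Sum>n<L. \<bar>b n\<bar> powr p)" for L
      using p by (intro tendsto_sum tendsto_powr2 tendsto_rabs lim tendsto_const) auto
    ultimately have L: "(\<Sum>n<L. \<bar>b n\<bar> powr p) \<le> e powr M" for L
      using tendsto_upperbound trivial_limit_sequentially by blast
    have sb: "summable (\<lambda>n. \<bar>b n\<bar> powr p)"
      using L by (intro summableI_nonneg_bounded) auto
    have "(\<Sum>n. \<bar>b n\<bar> powr p) powr min 1 (1 / p) \<le> (e powr M) powr min 1 (1 / p)"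
      using L p sb by (intro powr_mono2 suminf_le_const) (auto intro: suminf_nonneg)
    also have "\<dots> = e" using e0 M by (simp add: powr_powr mult.commute)
    finally show ?thesis using p sb by (simp add: seq_norm_pos lp_pos_iff)
  qed
  then show "p > 0 \<Longrightarrow> b \<in> lp p" by blast
  show "seq_norm p b \<le> e"
  proof (cases "p = 0")
    case True
    have "\<bar>b n\<bar> \<le> e" for n
    proof (rule tendsto_upperbound)
      show "(\<lambda>m. \<bar>a m n\<bar>) \<longlonglongrightarrow> \<bar>b n\<bar>" by (intro tendsto_rabs lim)
      show "\<forall>\<^sub>F m in sequentially. \<bar>a m n\<bar> \<le> e"
        using le
      proof eventually_elim
        case (elim m)
        then show ?case using abs_le_seq_norm[OF p a, of m n] seq_norm_nonneg[OF p a, of m] True by simp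
      qed
    qed simp
    then show ?thesis unfolding True seq_norm_0 by (intro cSUP_least) auto
  qed (use pos p in auto)
qed

text \<open>Each coordinate is Cauchy because it is controlled by a power of the distance, and the
  Fatou bound turns the Cauchy estimate into convergence. Membership in \<open>lp p\<close> is asked
  of differences, so that sequences near 1 are covered.\<close>

lemma seq_dist_complete:
  fixes X :: "nat \<Rightarrow> nat \<Rightarrow> 'a::complete_space"
  assumes p: "p \<ge> 0"
    and fin: "\<And>m k. (\<lambda>n. dist (X m n) (X k n)) \<in> lp p"
    and Cauchy: "\<And>e. e > 0 \<Longrightarrow> \<exists>N. \<forall>m\<ge>N. \<forall>k\<ge>N. seq_dist p (X m) (X k) < e"
  obtains Z where "\<And>n. (\<lambda>m. X m n) \<longlonglongrightarrow> Z n"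
    and "\<And>m. (\<lambda>n. dist (X m n) (Z n)) \<in> lp p"
    and "(\<lambda>m. seq_dist p (X m) Z) \<longlonglongrightarrow> 0"
proof -
  define M where "M = max 1 (1 / p)"
  have M: "M > 0" by (simp add: M_def)
  have co: "dist (X m n) (X k n) \<le> seq_dist p (X m) (X k) powr M" for m k n
    using abs_le_seq_norm[OF p fin[of m k], of n] by (simp add: seq_dist_eq_seq_norm M_def)
  have nn: "seq_dist p (X m) (X k) \<ge> 0" for m k
    using seq_norm_nonneg[OF p fin] by (simp add: seq_dist_eq_seq_norm)
  have "Cauchy (\<lambda>m. X m n)" for n
  proof (rule metric_CauchyI)
    fix e :: real assume e: "e > 0"
    then obtain N where N: "\<forall>m\<ge>N. \<forall>k\<ge>N. seq_dist p (X m) (X k) < e powr (1 / M)"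
      using Cauchy[of "e powr (1 / M)"] by auto
    have "dist (X m n) (X k n) < e" if "m \<ge> N" "k \<ge> N" for m k
    proof -
      have "seq_dist p (X m) (X k) powr M < (e powr (1 / M)) powr M"
        using N that M nn by (intro powr_less_mono2) auto
      then show ?thesis using co[of m n k] e M by (simp add: powr_powr)
    qed
    then show "\<exists>N. \<forall>m\<ge>N. \<forall>k\<ge>N. dist (X m n) (X k n) < e" by blast
  qed
  then have "\<exists>z. (\<lambda>m. X m n) \<longlonglongrightarrow> z" for n by (metis Cauchy_convergent convergent_def)
  then obtain Z where Z: "\<And>n. (\<lambda>m. X m n) \<longlonglongrightarrow> Z n" by metis
  have lim: "(\<lambda>k. dist (X m n) (X k n)) \<longlonglongrightarrow> dist (X m n) (Z n)" for m n
    by (intro tendsto_dist tendsto_const Z)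
  have close: "\<exists>N. \<forall>m\<ge>N. seq_norm p (\<lambda>n. dist (X m n) (Z n)) \<le> e \<and>
      (p > 0 \<longrightarrow> (\<lambda>n. dist (X m n) (Z n)) \<in> lp p)" if e: "e > 0" for e
  proof -
    obtain N where N: "\<forall>m\<ge>N. \<forall>k\<ge>N. seq_dist p (X m) (X k) < e"
      using Cauchy[OF e] by auto
    have "seq_norm p (\<lambda>n. dist (X m n) (Z n)) \<le> e \<and>
        (p > 0 \<longrightarrow> (\<lambda>n. dist (X m n) (Z n)) \<in> lp p)" if "m \<ge> N" for m
    proof -
      have ev: "\<forall>\<^sub>F k in sequentially. seq_norm p (\<lambda>n. dist (X m n) (X k n)) \<le> e"
        using eventually_ge_at_top[of N]
        by eventually_elim (use N that in \<open>auto simp: seq_dist_eq_seq_norm intro: less_imp_le\<close>)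
      show ?thesis using seq_norm_Fatou[OF p fin ev lim] by blast
    qed
    then show ?thesis by blast
  qed
  have mem: "(\<lambda>n. dist (X m n) (Z n)) \<in> lp p" for m
  proof (cases "p = 0")
    case False
    \<comment> \<open>The Fatou bound yields membership for one large index \<open>N\<close>; the
      triangle inequality through \<open>X N\<close> carries it to every \<open>m\<close>.\<close>
    obtain N where N: "(\<lambda>n. dist (X N n) (Z n)) \<in> lp p"
      using close[of 1] False p by auto
    show ?thesis
      by (rule lp_mono[OF p lp_add[OF p fin[of m N] N], of _ 1]) (simp add: dist_triangle)
  next
    case True
    \<comment> \<open>A pointwise limit of null sequences need not be null, so here the uniform Cauchy property
      is needed.\<close>
    have "(\<lambda>n. dist (X m n) (Z n)) \<longlonglongrightarrow> 0"
    proof (rule LIMSEQ_I)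
      fix e :: real assume e: "e > 0"
      then obtain N where N: "\<forall>k\<ge>N. \<forall>l\<ge>N. seq_dist p (X k) (X l) < e / 2"
        using Cauchy[of "e / 2"] by auto
      have kl: "dist (X N n) (X l n) \<le> e / 2" if "l \<ge> N" for l n
      proof -
        have "seq_dist p (X N) (X l) < e / 2" using N that by blast
        then show ?thesis using co[of N n l] nn[of N l] True by (simp add: M_def)
      qed
      have NZ: "dist (X N n) (Z n) \<le> e / 2" for n
        using kl by (intro tendsto_upperbound[OF lim] eventually_sequentiallyI[of N]) auto
      have "(\<lambda>n. dist (X m n) (X N n)) \<longlonglongrightarrow> 0" using fin True by (simp add: lp_0_iff)
      then obtain no where no: "\<forall>n\<ge>no. dist (X m n) (X N n) < e / 2"
        using LIMSEQ_D[of "\<lambda>n. dist (X m n) (X N n)" 0 "e / 2"] e by auto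
      have "dist (X m n) (Z n) < e" if "n \<ge> no" for n
        using dist_triangle[of "X m n" "Z n" "X N n"] NZ[of n] no[rule_format, OF that] by linarith
      then show "\<exists>no. \<forall>n\<ge>no. norm (dist (X m n) (Z n) - 0) < e" by auto
    qed
    then show ?thesis using True by (simp add: lp_0_iff)
  qed
  have "(\<lambda>m. seq_dist p (X m) Z) \<longlonglongrightarrow> 0"
  proof (rule LIMSEQ_I)
    fix e :: real assume e: "e > 0"
    then obtain N where N: "\<forall>m\<ge>N. seq_norm p (\<lambda>n. dist (X m n) (Z n)) \<le> e / 2"
      using close[of "e / 2"] by auto
    have "norm (seq_dist p (X m) Z - 0) < e" if "m \<ge> N" for m
    proof -
      have "seq_dist p (X m) Z \<le> e / 2" "seq_dist p (X m) Z \<ge> 0"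
        using N that seq_norm_nonneg[OF p mem] by (auto simp: seq_dist_eq_seq_norm)
      then show ?thesis using e by simp
    qed
    then show "\<exists>no. \<forall>m\<ge>no. norm (seq_dist p (X m) Z - 0) < e" by blast
  qed
  then show thesis using that Z mem by blast
qed

lemma lp_finite_support:
  assumes "\<And>n. n \<ge> N \<Longrightarrow> a n = 0"
  shows "a \<in> lp p"
proof -
  have "a \<longlonglongrightarrow> 0"
    using assms by (intro tendsto_eventually eventually_sequentiallyI[of N])
  moreover have "summable (\<lambda>n. \<bar>a n\<bar> powr p)"
    using assms by (intro summable_finite[of "{..<N}"]) (simp_all add: not_less)
  ultimately show ?thesis by (simp add: lp_def)
qed

text \<open>Terms of a convergent series tend to 0, and so do their \<open>p\<close>-th roots. For
  the kernel below, this makes integer sequences in \<open>lp p\<close> eventually zero.\<close>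

lemma lp_imp_null:
  assumes p: "p \<ge> 0" and a: "a \<in> lp p"
  shows "a \<longlonglongrightarrow> 0"
proof (cases "p = 0")
  case False
  with p have p: "p > 0" by simp
  have "(\<lambda>n. \<bar>a n\<bar> powr p) \<longlonglongrightarrow> 0"
    using a p by (intro summable_LIMSEQ_zero) (simp add: lp_pos_iff)
  then have "(\<lambda>n. (\<bar>a n\<bar> powr p) powr (1 / p)) \<longlonglongrightarrow> 0 powr (1 / p)"
    using p by (intro tendsto_powr2 tendsto_const) auto
  then show ?thesis using p by (simp add: powr_powr tendsto_rabs_zero_iff)
qed (use a in \<open>simp add: lp_0_iff\<close>)

section \<open>Arcs and chords on the unit circle\<close>

lemma norm_1_nonzero: "norm (z :: complex) = 1 \<Longrightarrow> z \<noteq> 0"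
  by auto

text \<open>A chord is at most as long as its arc: once the rotation \<open>cis b\<close> is
  factored out, its length is twice the absolute sine of half the angle.\<close>

lemma dist_cis_le: "dist (cis a) (cis b) \<le> \<bar>a - b\<bar>"
proof -
  have "cis a - cis b = cis b * (cis (a - b) - 1)"
    by (simp add: cis_mult right_diff_distrib)
  then have "dist (cis a) (cis b) = norm (cis (a - b) - 1)"
    by (simp add: dist_norm norm_mult)
  also have "\<dots> = 2 * \<bar>sin ((a - b) / 2)\<bar>"
    using dist_exp_i_1[of "a - b"] by (simp add: cis_conv_exp)
  also have "\<dots> \<le> 2 * \<bar>(a - b) / 2\<bar>"
    by (intro mult_left_mono abs_sin_x_le_abs_x) auto
  finally show ?thesis by simp
qed

text \<open>Inversion on the unit circle is complex conjugation, hence an isometry.\<close>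

lemma dist_inverse_unit:
  fixes a b :: complex
  assumes "norm a = 1" "norm b = 1"
  shows "dist (inverse a) (inverse b) = dist a b"
proof -
  have "a \<noteq> 0" "b \<noteq> 0" using assms by auto
  then have "inverse a - inverse b = - (inverse a * (a - b) * inverse b)"
    by (rule inverse_diff_inverse)
  then show ?thesis using assms by (simp add: dist_norm norm_mult norm_inverse)
qed

lemma cis_2pi_eq_1_iff: "cis (2 * pi * t) = 1 \<longleftrightarrow> t \<in> \<int>"
proof
  assume "cis (2 * pi * t) = 1"
  then have "cos (2 * pi * t) = 1" by (metis cis.sel(1) one_complex.sel(1))
  then obtain k :: int where "2 * pi * t = of_int k * 2 * pi" by (auto simp: cos_one_2pi_int)
  then show "t \<in> \<int>" by auto
qed (rule cis_multiple_2pi)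

text \<open>With \<open>s\<close> half the principal angle in absolute value, the chord is
  \<open>2 * sin s\<close>, and a third-order Taylor bound gives \<open>sin s \<ge> s / 2\<close>.
  The constant 2 exceeds the optimal \<open>pi / 2\<close> but stays below the factor
  \<open>2 * pi\<close> in \<open>winding\<close>.\<close>

lemma abs_Arg_le:
  assumes "norm z = 1"
  shows "\<bar>Arg z\<bar> \<le> 2 * dist 1 z"
proof -
  define s where "s = \<bar>Arg z / 2\<bar>"
  \<comment> \<open>The bound 1.6 lies just above \<open>pi / 2\<close>; its square is below 3, so
    the cubic error is at most \<open>s / 2\<close>.\<close>
  have s: "0 \<le> s" "s \<le> 1.6"
    using Arg_bounded[of z] pi_less_4 pi_approx by (auto simp: s_def)
  have "\<bar>sin s - s\<bar> \<le> s ^ 3 / 6"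
    using Maclaurin_sin_bound[of s 3] s
    by (simp add: eval_nat_numeral sin_coeff_def field_simps)
  moreover have "s ^ 3 \<le> 3 * s"
  proof -
    have "s * s \<le> 1.6 * 1.6" using s by (intro mult_mono) auto
    then have "s * (s * s) \<le> s * 3" using s by (intro mult_left_mono) auto
    then show ?thesis by (simp add: eval_nat_numeral)
  qed
  ultimately have "s \<le> 2 * sin s" by linarith
  also have "sin s \<le> \<bar>sin (Arg z / 2)\<bar>" by (auto simp: s_def abs_if)
  finally have "s \<le> 2 * \<bar>sin (Arg z / 2)\<bar>" by simp
  moreover have "cis (Arg z) = z" using assms norm_1_nonzero[of z] by (simp add: cis_Arg sgn_eq)
  then have "dist 1 z = 2 * \<bar>sin (Arg z / 2)\<bar>"
    using dist_exp_i_1[of "Arg z"] by (simp add: cis_conv_exp dist_norm norm_minus_commute)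
  ultimately show ?thesis by (simp add: s_def)
qed

text \<open>Rotating \<open>v\<close> by one \<open>k\<close>-th of the principal angle of
  \<open>c / v ^ k\<close> gives a \<open>k\<close>-th root of \<open>c\<close>, and that angle is
  at most \<open>pi\<close> in absolute value. The last clause makes coordinatewise choices preserve
  finite support.\<close>

lemma root_near:
  fixes v c :: complex
  assumes "norm v = 1" "norm c = 1" "k > 0"
  obtains g where "norm g = 1" "g ^ k = c" "dist v g \<le> pi / real k" "v = 1 \<Longrightarrow> c = 1 \<Longrightarrow> g = 1"
proof
  define \<theta> where "\<theta> = Arg (c / v ^ k)"
  have "norm (c / v ^ k) = 1" using assms by (simp add: norm_divide norm_power)
  then have c: "cis \<theta> = c / v ^ k"
    unfolding \<theta>_def using norm_1_nonzero[of "c / v ^ k"] by (simp add: cis_Arg sgn_eq)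
  have v: "v \<noteq> 0" using assms by auto
  let ?g = "v * cis (\<theta> / k)"
  show "norm ?g = 1" using assms by (simp add: norm_mult)
  have "cis (\<theta> / k) ^ k = cis \<theta>" using assms by (subst Complex.DeMoivre) simp
  then show "?g ^ k = c" using v by (simp add: power_mult_distrib c)
  have "dist v ?g = norm (v * (1 - cis (\<theta> / k)))" by (simp add: dist_norm right_diff_distrib)
  also have "\<dots> = dist (cis 0) (cis (\<theta> / k))" using assms by (simp add: norm_mult dist_norm)
  also have "\<dots> \<le> \<bar>\<theta>\<bar> / k" using dist_cis_le[of 0 "\<theta> / k"] by simp
  also have "\<dots> \<le> pi / real k"
    using Arg_bounded[of "c / v ^ k"] by (intro divide_right_mono) (auto simp: \<theta>_def)
  finally show "dist v ?g \<le> pi / real k" .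
  show "?g = 1" if "v = 1" "c = 1" using that by (simp add: \<theta>_def)
qed

lemma Lipschitz_imp_continuous_map:
  assumes "Metric_space M d" "Metric_space M' d'" "f ` M \<subseteq> M'"
    and le: "\<And>x y. x \<in> M \<Longrightarrow> y \<in> M \<Longrightarrow> d' (f x) (f y) \<le> c * d x y"
  shows "continuous_map (Metric_space.mtopology M d) (Metric_space.mtopology M' d') f"
  unfolding Metric_space.metric_continuous_map[OF assms(1,2)]
proof (intro conjI assms ballI allI impI)
  fix a and e :: real assume a: "a \<in> M" and e: "e > 0"
  have "d' (f a) (f x) < e" if x: "x \<in> M" "d a x < e / (\<bar>c\<bar> + 1)" for x
  proof -
    have nn: "d a x \<ge> 0" using Metric_space.nonneg[OF assms(1)] .
    have "d' (f a) (f x) \<le> (\<bar>c\<bar> + 1) * d a x"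
      using le[OF a x(1)] mult_right_mono[OF _ nn, of c "\<bar>c\<bar> + 1"] by linarith
    also have "\<dots> < e" using x by (simp add: field_simps)
    finally show ?thesis .
  qed
  then show "\<exists>\<delta>>0. \<forall>x. x \<in> M \<and> d a x < \<delta> \<longrightarrow> d' (f a) (f x) < e"
    using e by (intro exI[of _ "e / (\<bar>c\<bar> + 1)"]) (auto intro!: divide_pos_pos)
qed

section \<open>The torus groups\<close>

text \<open>Unites the null case and the summable case, so that facts about real sequences in
  \<open>lp p\<close> apply to the torus.\<close>

lemma TH_iff:
  assumes p: "p \<ge> 0"
  shows "z \<in> TH p \<longleftrightarrow> (\<forall>n. norm (z n) = 1) \<and> (\<lambda>n. dist 1 (z n)) \<in> lp p"
  using tendsto_dist_iff[of z 1 sequentially]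
  by (simp add: TH_def lp_def dist_norm norm_minus_commute)

text \<open>Lists encode finitely supported torus elements, so a countable alphabet yields countably
  many of them.\<close>

definition pad :: "complex list \<Rightarrow> nat \<Rightarrow> complex" where
  "pad l n = (if n < length l then l ! n else 1)"

text \<open>The universal covering of the circle in each coordinate, scaled to period 1 so that
  integers map to 1.\<close>

definition winding :: "(nat \<Rightarrow> real) \<Rightarrow> nat \<Rightarrow> complex" where
  "winding x n = cis (2 * pi * x n)"

locale nonneg_exponent =
  fixes p :: real
  assumes p: "0 \<le> p"
begin

sublocale T: Metric_space "TH p" "seq_dist_on (TH p) p"
  by (rule Metric_space_TH[OF p])

sublocale L: Metric_space "lp p" "seq_dist_on (lp p) p"
  by (rule Metric_space_lp[OF p])

lemma TH_I: "(\<And>n. norm (z n) = 1) \<Longrightarrow> (\<lambda>n. dist 1 (z n)) \<in> lp p \<Longrightarrow> z \<in> TH p"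
  by (simp add: TH_iff[OF p])

lemma TH_norm: "z \<in> TH p \<Longrightarrow> norm (z n) = 1"
  by (simp add: TH_iff[OF p])

lemma TH_lp: "z \<in> TH p \<Longrightarrow> (\<lambda>n. dist 1 (z n)) \<in> lp p"
  by (simp add: TH_iff[OF p])

lemma TH_dist_lp:
  assumes "z \<in> TH p" "w \<in> TH p"
  shows "(\<lambda>n. dist (z n) (w n)) \<in> lp p"
  by (rule lp_mono[OF p lp_add[OF p TH_lp[OF assms(1)] TH_lp[OF assms(2)]], of _ 1])
    (simp add: dist_triangle3)

lemma lp_dist_lp:
  assumes "x \<in> lp p" "y \<in> lp p"
  shows "(\<lambda>n. dist (x n) (y n)) \<in> lp p"
  using lp_abs[OF p lp_add[OF p assms(1) lp_uminus[OF assms(2)]]] by (simp add: dist_real_def)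

lemma seq_dist_on_eq:
  "x \<in> M \<Longrightarrow> y \<in> M \<Longrightarrow> seq_dist_on M p x y = seq_norm p (\<lambda>n. dist (x n) (y n))"
  by (simp add: seq_dist_on_def seq_dist_eq_seq_norm)

section \<open>Group structure on the torus sequences\<close>

lemma TH_mult:
  assumes "z \<in> TH p" "w \<in> TH p"
  shows "(\<lambda>n. z n * w n) \<in> TH p"
proof (rule TH_I)
  fix n
  show "norm (z n * w n) = 1" using assms by (simp add: TH_norm norm_mult)
next
  show "(\<lambda>n. dist 1 (z n * w n)) \<in> lp p"
  proof (rule lp_mono[OF p lp_add[OF p TH_lp[OF assms(1)] TH_lp[OF assms(2)]], of _ 1])
    fix n
    \<comment> \<open>Multiplication by the unimodular \<open>z n\<close> preserves distances, so
      the distances of the factors from 1 add up.\<close>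
    have "dist 1 (z n * w n) \<le> dist 1 (z n) + dist (z n) (z n * w n)" by (rule dist_triangle)
    also have "dist (z n) (z n * w n) = norm (z n * (1 - w n))"
      by (simp add: dist_norm right_diff_distrib)
    also have "\<dots> = dist 1 (w n)" using assms by (simp add: norm_mult TH_norm dist_norm)
    finally show "\<bar>dist 1 (z n * w n)\<bar> \<le> 1 * \<bar>dist 1 (z n) + dist 1 (w n)\<bar>" by simp
  qed
qed

lemma TH_inverse:
  assumes "z \<in> TH p"
  shows "(\<lambda>n. inverse (z n)) \<in> TH p"
proof (rule TH_I)
  show "(\<lambda>n. dist 1 (inverse (z n))) \<in> lp p"
    using TH_lp[OF assms] dist_inverse_unit[of 1] TH_norm[OF assms] by simp
qed (use assms in \<open>simp add: norm_inverse TH_norm\<close>)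

lemma TH_one: "(\<lambda>n. 1) \<in> TH p"
  by (rule TH_I) (auto intro: lp_finite_support)

sublocale G: comm_group "TH_group p"
proof (rule comm_groupI)
  fix z assume "z \<in> carrier (TH_group p)"
  then show "\<exists>w\<in>carrier (TH_group p). w \<otimes>\<^bsub>TH_group p\<^esub> z = \<one>\<^bsub>TH_group p\<^esub>"
    by (intro bexI[of _ "\<lambda>n. inverse (z n)"])
      (auto simp: TH_group_def TH_inverse norm_1_nonzero TH_norm)
qed (auto simp: TH_group_def TH_mult TH_one mult_ac)

lemma TH_inv:
  assumes "z \<in> TH p"
  shows "inv\<^bsub>TH_group p\<^esub> z = (\<lambda>n. inverse (z n))"
  using assms
  by (intro G.inv_equality) (auto simp: TH_group_def TH_inverse norm_1_nonzero TH_norm)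

lemma TH_power: "z \<in> TH p \<Longrightarrow> (\<lambda>n. z n ^ k) \<in> TH p"
  by (induction k) (auto simp: TH_one TH_mult)

lemma TH_nat_pow: "z \<in> TH p \<Longrightarrow> z [^]\<^bsub>TH_group p\<^esub> (k :: nat) = (\<lambda>n. z n ^ k)"
  by (induction k) (auto simp: TH_group_def mult.commute)

section \<open>Continuity of the group operations\<close>

lemma TH_topology_eq: "TH_topology p = T.mtopology"
  by (simp add: seq_topology_def)

lemma lp_topology_eq: "lp_topology p = L.mtopology"
  by (simp add: seq_topology_def)

text \<open>The metric is translation invariant, so moving each factor by less than
  \<open>e / 2\<close> moves the product by less than \<open>e\<close>, by the triangle inequality
  through \<open>z n * w' n\<close>.\<close>

lemma continuous_map_TH_mult:
  "continuous_map (prod_topology T.mtopology T.mtopology) T.mtopology (\<lambda>(z, w). z \<otimes>\<^bsub>TH_group p\<^esub> w)"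
  unfolding T.continuous_map_to_metric
proof (intro ballI allI impI)
  fix u and e :: real assume u: "u \<in> topspace (prod_topology T.mtopology T.mtopology)" and e: "e > 0"
  then obtain z w where zw: "u = (z, w)" "z \<in> TH p" "w \<in> TH p" by auto
  have eq: "seq_dist_on (TH p) p (\<lambda>n. a n * b n) (\<lambda>n. a n * c n) = seq_dist_on (TH p) p b c"
    if "a \<in> TH p" "b \<in> TH p" "c \<in> TH p" for a b c
  proof -
    have "dist (a n * b n) (a n * c n) = dist (b n) (c n)" for n
      using TH_norm[OF that(1), of n]
      by (simp add: dist_norm norm_mult flip: right_diff_distrib)
    then show ?thesis using that by (simp add: seq_dist_on_eq TH_mult)
  qed
  have "(\<lambda>n. z' n * w' n) \<in> T.mball (\<lambda>n. z n * w n) e"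
    if "z' \<in> T.mball z (e / 2)" "w' \<in> T.mball w (e / 2)" for z' w'
  proof -
    have in_TH: "z' \<in> TH p" "w' \<in> TH p" using that by auto
    have "seq_dist_on (TH p) p (\<lambda>n. z n * w n) (\<lambda>n. z' n * w' n)
        \<le> seq_dist_on (TH p) p (\<lambda>n. z n * w n) (\<lambda>n. z n * w' n)
          + seq_dist_on (TH p) p (\<lambda>n. z n * w' n) (\<lambda>n. z' n * w' n)"
      using in_TH zw by (intro T.triangle TH_mult)
    also have "\<dots> = seq_dist_on (TH p) p w w' + seq_dist_on (TH p) p z z'"
      using eq[of z w w'] eq[of w' z z'] in_TH zw by (simp add: mult.commute)
    also have "\<dots> < e" using that by simp
    finally show ?thesis using in_TH zw by (simp add: TH_mult)
  qed
  then show "\<exists>U. openin (prod_topology T.mtopology T.mtopology) U \<and> u \<in> U \<and>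
      (\<forall>v\<in>U. (case v of (z, w) \<Rightarrow> z \<otimes>\<^bsub>TH_group p\<^esub> w) \<in>
        T.mball (case u of (z, w) \<Rightarrow> z \<otimes>\<^bsub>TH_group p\<^esub> w) e)"
    using zw e
    by (intro exI[of _ "T.mball z (e / 2) \<times> T.mball w (e / 2)"])
      (auto simp: openin_prod_Times_iff TH_group_def)
qed

lemma topological_group_TH: "topological_group (TH_group p) (TH_topology p)"
  unfolding topological_group_def TH_topology_eq
proof (intro conjI)
  have "continuous_map T.mtopology T.mtopology (\<lambda>z n. inverse (z n))"
    by (rule Lipschitz_imp_continuous_map[OF T.Metric_space_axioms T.Metric_space_axioms, of _ 1])
      (auto simp: TH_inverse seq_dist_on_eq dist_inverse_unit TH_norm)
  then show "continuous_map T.mtopology T.mtopology (\<lambda>z. inv\<^bsub>TH_group p\<^esub> z)"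
    by (rule continuous_map_eq) (simp add: TH_inv)
qed (use continuous_map_TH_mult G.group_axioms in \<open>auto simp: TH_group_def\<close>)

section \<open>Completeness\<close>

lemma mcomplete_TH: "T.mcomplete"
  unfolding T.mcomplete_def
proof (intro allI impI)
  fix X assume "T.MCauchy X"
  then have X: "X m \<in> TH p" for m by (auto simp: T.MCauchy_def)
  have "\<exists>N. \<forall>m\<ge>N. \<forall>k\<ge>N. seq_dist p (X m) (X k) < e" if "e > 0" for e
    using \<open>T.MCauchy X\<close> X that by (auto simp: T.MCauchy_def seq_dist_on_def)
  then obtain Z where Z: "\<And>n. (\<lambda>m. X m n) \<longlonglongrightarrow> Z n"
    and Z_lp: "\<And>m. (\<lambda>n. dist (X m n) (Z n)) \<in> lp p"
    and lim: "(\<lambda>m. seq_dist p (X m) Z) \<longlonglongrightarrow> 0"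
    using seq_dist_complete[OF p TH_dist_lp[OF X X], of "\<lambda>m. m"] by blast
  \<comment> \<open>Unit modulus passes to coordinatewise limits, and the distance of
    \<open>Z n\<close> from 1 is dominated by going through \<open>X 0 n\<close>.\<close>
  have Z_TH: "Z \<in> TH p"
  proof (rule TH_I)
    fix n
    have "(\<lambda>m. norm (X m n)) \<longlonglongrightarrow> norm (Z n)" by (intro tendsto_norm Z)
    then show "norm (Z n) = 1" using X by (simp add: TH_norm LIMSEQ_const_iff)
  next
    show "(\<lambda>n. dist 1 (Z n)) \<in> lp p"
      by (rule lp_mono[OF p lp_add[OF p TH_lp[OF X[of 0]] Z_lp[of 0]], of _ 1])
        (simp add: dist_triangle)
  qed
  then have "limitin T.mtopology X Z sequentially"
    using X lim by (simp add: T.limitin_metric_dist_null seq_dist_on_def)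
  then show "\<exists>Z. limitin T.mtopology X Z sequentially" by (intro exI[of _ Z])
qed

section \<open>Density of finitely supported points and separability\<close>

lemma pad_in_TH: "set l \<subseteq> sphere 0 1 \<Longrightarrow> pad l \<in> TH p"
  by (rule TH_I) (auto simp: pad_def subset_iff intro: lp_finite_support[of "length l"])

text \<open>First the tail of \<open>z\<close> is replaced by ones, then each of the finitely many
  remaining coordinates is moved into \<open>A\<close>. A general \<open>A\<close> serves both a
  countable dense alphabet and the whole circle.\<close>

lemma pad_dense:
  assumes A: "A \<subseteq> sphere 0 1" "sphere 0 1 \<subseteq> closure A" and z: "z \<in> TH p" and e: "e > 0"
  obtains l where "l \<in> lists A" "seq_dist_on (TH p) p z (pad l) < e"
proof -
  have "\<forall>\<^sub>F N in sequentially. seq_norm p (\<lambda>n. if n < N then 0 else dist 1 (z n)) < e / 2"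
    using seq_norm_tail[OF p TH_lp[OF z]] e by (intro order_tendstoD) auto
  then obtain N where N: "seq_norm p (\<lambda>n. if n < N then 0 else dist 1 (z n)) < e / 2"
    using eventually_happens' sequentially_bot by blast
  let ?w = "pad (map z [0..<N])"
  have w: "?w \<in> TH p" using z by (intro pad_in_TH) (auto simp: TH_norm)
  have "(\<lambda>n. dist (z n) (?w n)) = (\<lambda>n. if n < N then 0 else dist 1 (z n))"
    by (auto simp: pad_def dist_commute)
  then have zw: "seq_dist_on (TH p) p z ?w < e / 2" using N z w by (simp add: seq_dist_on_eq)
  obtain \<delta> where \<delta>: "\<delta> > 0"
    "\<And>a. (\<And>n. n < N \<Longrightarrow> \<bar>a n\<bar> < \<delta>) \<Longrightarrow> (\<And>n. n \<ge> N \<Longrightarrow> a n = 0) \<Longrightarrow> seq_norm p a < e / 2"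
    using seq_norm_finite_small[OF p, of "e / 2" N] e by auto
  have "\<exists>a\<in>A. dist a (z n) < \<delta>" for n
    using A z \<delta>(1) by (auto simp: closure_approachable TH_norm subset_iff)
  then obtain a where a: "\<And>n. a n \<in> A" "\<And>n. dist (a n) (z n) < \<delta>" by metis
  let ?l = "map a [0..<N]"
  have l: "?l \<in> lists A" using a by auto
  have "seq_norm p (\<lambda>n. dist (?w n) (pad ?l n)) < e / 2"
    by (rule \<delta>(2)) (use a(2) in \<open>auto simp: pad_def dist_commute\<close>)
  moreover have lT: "pad ?l \<in> TH p" using a(1) A(1) by (intro pad_in_TH) auto
  ultimately have "seq_dist_on (TH p) p ?w (pad ?l) < e / 2" using w by (simp add: seq_dist_on_eq)
  then have "seq_dist_on (TH p) p z (pad ?l) < e"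
    using T.triangle[OF z w lT] zw by linarith
  then show thesis using that l by blast
qed

text \<open>The set consists of lists over a countable dense subset of the circle. Finite support is
  recorded because \<open>power_hits_dense\<close> extracts roots of such points.\<close>

lemma countable_dense_TH:
  "\<exists>C. countable C \<and> C \<subseteq> pad ` lists (sphere 0 1) \<and>
     (\<forall>z\<in>TH p. \<forall>e>0. \<exists>c\<in>C. seq_dist_on (TH p) p z c < e)"
proof -
  obtain A :: "complex set" where A: "countable A" "A \<subseteq> sphere 0 1" "sphere 0 1 \<subseteq> closure A"
    by (rule separable[of "sphere (0 :: complex) 1"])
  show ?thesis
  proof (intro exI[of _ "pad ` lists A"] conjI ballI allI impI)
    show "countable (pad ` lists A)"
      using A(1) by (intro countable_image countable_lists)
    show "pad ` lists A \<subseteq> pad ` lists (sphere 0 1)"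
      by (rule image_mono[OF lists_mono[OF A(2)]])
    fix z and e :: real assume "z \<in> TH p" "e > 0"
    then obtain l where "l \<in> lists A" "seq_dist_on (TH p) p z (pad l) < e"
      by (rule pad_dense[OF A(2,3)])
    then show "\<exists>c\<in>pad ` lists A. seq_dist_on (TH p) p z c < e"
      by (intro bexI[of _ "pad l"] imageI)
  qed
qed

lemma polish_group_TH: "polish_group (TH_group p) (TH_topology p)"
  unfolding polish_group_def
proof (intro conjI topological_group_TH)
  show "completely_metrizable_space (TH_topology p)"
    unfolding TH_topology_eq by (rule T.completely_metrizable_space_mtopology[OF mcomplete_TH])
  obtain C where C: "countable C" "C \<subseteq> pad ` lists (sphere 0 1)"
    and "\<forall>z\<in>TH p. \<forall>e>0. \<exists>c\<in>C. seq_dist_on (TH p) p z c < e"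
    using countable_dense_TH by blast
  note dense = this(3)[rule_format]
  have CT: "C \<subseteq> TH p" using C(2) pad_in_TH by (force simp: in_lists_conv_set)
  have "T.mtopology closure_of C = TH p"
    using dense CT by (fastforce simp: T.metric_closure_of)
  then show "separable_space (TH_topology p)"
    using C(1) CT by (auto simp: separable_space_def TH_topology_eq)
qed

section \<open>A topological generator by Baire category\<close>

lemma continuous_map_TH_power: "continuous_map T.mtopology T.mtopology (\<lambda>g n. g n ^ k)"
proof (rule Lipschitz_imp_continuous_map[OF T.Metric_space_axioms T.Metric_space_axioms])
  fix g h assume gh: "g \<in> TH p" "h \<in> TH p"
  \<comment> \<open>The factor \<open>k\<close> is enlarged to \<open>Suc k\<close> because
    \<open>seq_norm_mono\<close> asks for a factor of at least 1 and \<open>k\<close> may be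
    0.\<close>
  have "dist (g n ^ k) (h n ^ k) \<le> real (Suc k) * dist (g n) (h n)" for n
  proof -
    have "dist (g n ^ k) (h n ^ k) \<le> real k * dist (g n) (h n)"
      using norm_power_diff[of "g n" "h n" k] gh by (simp add: dist_norm TH_norm)
    also have "\<dots> \<le> real (Suc k) * dist (g n) (h n)" by (intro mult_right_mono) auto
    finally show ?thesis .
  qed
  then show "seq_dist_on (TH p) p (\<lambda>n. g n ^ k) (\<lambda>n. h n ^ k) \<le> real (Suc k) * seq_dist_on (TH p) p g h"
    using gh seq_norm_mono[OF p TH_dist_lp[OF gh], of "real (Suc k)" "\<lambda>n. dist (g n ^ k) (h n ^ k)"]
    by (simp add: seq_dist_on_eq TH_power)
qed (auto simp: TH_power)

text \<open>Once \<open>z\<close> is replaced by a nearby finitely supported point, only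
  \<open>N\<close> coordinates can differ from 1, so a single large \<open>k\<close> makes the
  chosen \<open>k\<close>-th roots close in all of them at once.\<close>

lemma power_hits_dense:
  assumes c: "c \<in> pad ` lists (sphere 0 1)" and z: "z \<in> TH p" and e: "e > 0"
  obtains g k where "g \<in> TH p" "seq_dist_on (TH p) p z g < e" "(\<lambda>n. g n ^ k) = c"
proof -
  obtain l where l: "l \<in> lists (sphere 0 1)" "seq_dist_on (TH p) p z (pad l) < e / 2"
    using pad_dense[of "sphere 0 1" z "e / 2"] z e closure_subset by auto
  obtain l' where l': "l' \<in> lists (sphere 0 1)" "c = pad l'" using c by auto
  have v: "pad l \<in> TH p" and cT: "c \<in> TH p" using l l' by (auto intro!: pad_in_TH)
  define N where "N = max (length l) (length l')"
  have one: "pad l n = 1" "c n = 1" if "n \<ge> N" for n using that l' by (auto simp: N_def pad_def)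
  obtain \<delta> where \<delta>: "\<delta> > 0"
    "\<And>a. (\<And>n. n < N \<Longrightarrow> \<bar>a n\<bar> < \<delta>) \<Longrightarrow> (\<And>n. n \<ge> N \<Longrightarrow> a n = 0) \<Longrightarrow> seq_norm p a < e / 2"
    using seq_norm_finite_small[OF p, of "e / 2" N] e by auto
  \<comment> \<open>The roots from \<open>root_near\<close> lie within \<open>pi / k\<close> of
    \<open>pad l n\<close>, so this \<open>k\<close> brings them closer than
    \<open>\<delta>\<close>.\<close>
  obtain k :: nat where k: "real k > pi / \<delta>" using reals_Archimedean2 by blast
  then have k0: "k > 0" using \<delta>(1) by (auto intro!: Nat.gr0I simp: field_simps)
  have "pi / real k < \<delta>" using k k0 \<delta>(1) by (simp add: field_simps)
  moreover have "\<exists>g. norm g = 1 \<and> g ^ k = c n \<and> dist (pad l n) g \<le> pi / real k \<and>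
      (n \<ge> N \<longrightarrow> g = 1)" for n
    using root_near[OF TH_norm[OF v] TH_norm[OF cT] k0, of n n] one[of n] by metis
  then obtain g where g: "\<And>n. norm (g n) = 1" "\<And>n. g n ^ k = c n"
    "\<And>n. dist (pad l n) (g n) \<le> pi / real k" "\<And>n. n \<ge> N \<Longrightarrow> g n = 1" by metis
  ultimately have "dist (pad l n) (g n) < \<delta>" for n by (meson le_less_trans)
  then have "seq_norm p (\<lambda>n. dist (pad l n) (g n)) < e / 2"
    by (intro \<delta>(2)) (auto simp: g(4) one)
  moreover have gT: "g \<in> TH p"
    by (rule TH_I) (auto simp: g intro: lp_finite_support[of N])
  ultimately have "seq_dist_on (TH p) p z g < e"
    using T.triangle[OF z v gT] l(2) v by (simp add: seq_dist_on_eq)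
  then show thesis using that gT g(2) by blast
qed

lemma monothetic_group_TH: "monothetic_group (TH_group p) (TH_topology p)"
  unfolding monothetic_group_def
proof (intro conjI topological_group_TH)
  obtain C where C: "countable C" "C \<subseteq> pad ` lists (sphere 0 1)"
    and "\<forall>z\<in>TH p. \<forall>e>0. \<exists>c\<in>C. seq_dist_on (TH p) p z c < e"
    using countable_dense_TH by blast
  note dense = this(3)[rule_format]
  \<comment> \<open>\<open>W (c, m)\<close> collects the points with some power in the ball of
    radius \<open>1 / (m + 1)\<close> around \<open>c\<close>. Both indices range over countable
    sets, as Baire's theorem requires.\<close>
  define W where
    "W = (\<lambda>(c, m :: nat). \<Union>k. {g \<in> TH p. (\<lambda>n. g n ^ k) \<in> T.mball c (1 / Suc m)})"
  have "T.mtopology closure_of \<Inter>(W ` (C \<times> UNIV)) = TH p"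
  proof (rule T.metric_Baire_category[OF mcomplete_TH])
    show "countable (W ` (C \<times> UNIV))" using C(1) by auto
    fix V assume "V \<in> W ` (C \<times> UNIV)"
    then obtain c m where c: "c \<in> C" and V: "V = W (c, m)" by auto
    have "openin T.mtopology V"
      unfolding V W_def
      using openin_continuous_map_preimage[OF continuous_map_TH_power T.openin_mball]
      by (auto intro!: openin_Union)
    moreover have "T.mtopology closure_of V = TH p"
    proof -
      have "\<exists>g\<in>V. g \<in> T.mball z e" if z: "z \<in> TH p" and e: "e > 0" for z e
      proof -
        have "c \<in> pad ` lists (sphere 0 1)" using c C(2) by blast
        then obtain g k where g: "g \<in> TH p" "seq_dist_on (TH p) p z g < e" "(\<lambda>n. g n ^ k) = c"
          using power_hits_dense z e by metis
        have "c \<in> TH p" using TH_power[OF g(1), of k] g(3) by simp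
        then have "g \<in> V" unfolding V W_def using g by auto
        then show ?thesis using g z by auto
      qed
      then show ?thesis by (auto simp: T.metric_closure_of)
    qed
    ultimately show "openin T.mtopology V \<and> T.mtopology closure_of V = TH p" ..
  qed
  \<comment> \<open>The closure of the intersection contains the identity, so the intersection is
    nonempty.\<close>
  then have "\<Inter>(W ` (C \<times> UNIV)) \<noteq> {}" using TH_one by (auto simp del: INT_simps)
  then obtain g where g: "g \<in> \<Inter>(W ` (C \<times> UNIV))" by blast
  \<comment> \<open>An intersection over an empty family would be everything, so a member of
    \<open>C\<close> is produced before \<open>g \<in> TH p\<close> is read off.\<close>
  obtain c where "c \<in> C" using dense[OF TH_one, of 1] by auto
  with g have gT: "g \<in> TH p" by (auto simp: W_def)
  have pow: "(\<lambda>n. g n ^ k) \<in> generate (TH_group p) {g}" for k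
  proof -
    have gc: "g \<in> carrier (TH_group p)" using gT by (simp add: TH_group_def)
    have "g [^]\<^bsub>TH_group p\<^esub> int k \<in> generate (TH_group p) {g}"
      unfolding G.generate_pow[OF gc] by blast
    then show ?thesis using TH_nat_pow[OF gT] by (simp add: int_pow_int)
  qed
  \<comment> \<open>Powers of \<open>g\<close> come arbitrarily close to points of \<open>C\<close>,
    which come arbitrarily close to \<open>z\<close>; each approximation takes half of
    \<open>e\<close>.\<close>
  have "\<exists>h\<in>generate (TH_group p) {g}. h \<in> T.mball z e" if z: "z \<in> TH p" and e: "e > 0" for z e
  proof -
    obtain c where c: "c \<in> C" "seq_dist_on (TH p) p z c < e / 2"
      using dense[OF z, of "e / 2"] e by auto
    obtain m :: nat where m: "1 / Suc m < e / 2"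
      using reals_Archimedean[of "e / 2"] e by (auto simp: inverse_eq_divide)
    have "g \<in> W (c, m)" using g c(1) by auto
    then obtain k where k: "(\<lambda>n. g n ^ k) \<in> T.mball c (1 / Suc m)" unfolding W_def by auto
    then have "seq_dist_on (TH p) p z (\<lambda>n. g n ^ k) < e"
      using T.triangle[OF z, of c "\<lambda>n. g n ^ k"] c(2) m by auto
    then show ?thesis using pow[of k] z TH_power[OF gT, of k] by auto
  qed
  then have "T.mtopology closure_of generate (TH_group p) {g} = TH p"
    by (auto simp: T.metric_closure_of)
  then show "\<exists>g\<in>carrier (TH_group p).
      TH_topology p closure_of generate (TH_group p) {g} = topspace (TH_topology p)"
    using gT by (auto simp: TH_topology_eq TH_group_def)
qed

section \<open>The covering by sequence spaces\<close>

lemma winding_in_TH: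
  assumes "x \<in> lp p"
  shows "winding x \<in> TH p"
proof (rule TH_I)
  show "(\<lambda>n. dist 1 (winding x n)) \<in> lp p"
  proof (rule lp_mono[OF p assms, of _ "2 * pi"])
    fix n
    show "\<bar>dist 1 (winding x n)\<bar> \<le> 2 * pi * \<bar>x n\<bar>"
      using dist_cis_le[of 0 "2 * pi * x n"] by (simp add: winding_def abs_mult)
  qed
qed (simp add: winding_def)

lemma continuous_map_winding: "continuous_map L.mtopology T.mtopology winding"
proof (rule Lipschitz_imp_continuous_map[OF L.Metric_space_axioms T.Metric_space_axioms])
  fix x y assume xy: "x \<in> lp p" "y \<in> lp p"
  have "dist (winding x n) (winding y n) \<le> 2 * pi * dist (x n) (y n)" for n
    using dist_cis_le[of "2 * pi * x n" "2 * pi * y n"]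
    by (simp add: winding_def dist_real_def abs_mult flip: right_diff_distrib)
  moreover have "2 * pi \<ge> 1" using pi_ge_two by linarith
  ultimately show "seq_dist_on (TH p) p (winding x) (winding y) \<le> (2 * pi) * seq_dist_on (lp p) p x y"
    using seq_norm_mono[OF p lp_dist_lp[OF xy], of "2 * pi" "\<lambda>n. dist (winding x n) (winding y n)"] xy
    by (simp add: seq_dist_on_eq winding_in_TH)
qed (auto simp: winding_in_TH)

text \<open>Each coordinate of \<open>x\<close> is shifted by the principal angle of
  \<open>z n / winding x n\<close>, divided by \<open>2 * pi\<close>. The angle is at most twice the
  chord, so the shift is at most the chord. Lifting from zero yields surjectivity, from arbitrary
  \<open>x\<close> openness.\<close>

lemma winding_lift:
  assumes x: "x \<in> lp p" and z: "z \<in> TH p"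
  obtains y where "y \<in> lp p" "winding y = z"
    "seq_dist_on (lp p) p x y \<le> seq_dist_on (TH p) p (winding x) z"
proof
  note w = winding_in_TH[OF x]
  let ?t = "\<lambda>n. Arg (z n / winding x n) / (2 * pi)"
  let ?y = "\<lambda>n. x n + ?t n"
  have u: "norm (z n / winding x n) = 1" for n
    using TH_norm[OF z] TH_norm[OF w] by (simp add: norm_divide)
  have t: "\<bar>?t n\<bar> \<le> dist (winding x n) (z n)" for n
  proof -
    have "\<bar>?t n\<bar> \<le> \<bar>Arg (z n / winding x n)\<bar> / 2"
      using pi_ge_two by (simp add: abs_divide divide_simps mult_le_cancel_left1)
    also have "\<dots> \<le> dist 1 (z n / winding x n)" using abs_Arg_le[OF u[of n]] by simp
    also have "\<dots> = norm (winding x n * (1 - z n / winding x n))"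
      using TH_norm[OF w, of n] by (simp add: norm_mult dist_norm)
    also have "\<dots> = dist (winding x n) (z n)"
      using TH_norm[OF w, of n] norm_1_nonzero by (simp add: dist_norm right_diff_distrib)
    finally show ?thesis .
  qed
  have "?t \<in> lp p"
    by (rule lp_mono[OF p TH_dist_lp[OF w z], of _ 1]) (use t in simp)
  then show y: "?y \<in> lp p" by (rule lp_add[OF p x])
  show "winding ?y = z"
  proof
    fix n
    have "winding ?y n = winding x n * cis (Arg (z n / winding x n))"
      by (simp add: winding_def cis_mult distrib_left)
    also have "cis (Arg (z n / winding x n)) = z n / winding x n"
      using u[of n] by (subst cis_Arg) (auto simp: sgn_eq)
    finally show "winding ?y n = z n" using TH_norm[OF w, of n] norm_1_nonzero by simp
  qed
  show "seq_dist_on (lp p) p x ?y \<le> seq_dist_on (TH p) p (winding x) z"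
    using seq_norm_mono[OF p TH_dist_lp[OF w z], of 1 "\<lambda>n. dist (x n) (?y n)"] t x y w z
    by (simp add: seq_dist_on_eq dist_real_def)
qed

lemma winding_image: "winding ` lp p = TH p"
proof
  have "(\<lambda>n. 0) \<in> lp p" by (rule lp_finite_support) simp
  then show "TH p \<subseteq> winding ` lp p" by (metis image_eqI subsetI winding_lift)
qed (auto simp: winding_in_TH)

text \<open>By \<open>winding_lift\<close> the image of a ball of radius \<open>r\<close> about
  \<open>x\<close> contains the ball of the same radius about \<open>winding x\<close>, so the
  covering is open.\<close>

lemma quotient_map_winding: "quotient_map L.mtopology T.mtopology winding"
proof (rule continuous_open_imp_quotient_map[OF continuous_map_winding])
  show "open_map L.mtopology T.mtopology winding"
    unfolding open_map_def
  proof (intro allI impI)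
    fix U assume U: "openin L.mtopology U"
    show "openin T.mtopology (winding ` U)"
      unfolding T.openin_mtopology
    proof (intro conjI allI impI)
      have "U \<subseteq> lp p" using openin_subset[OF U] by simp
      then show "winding ` U \<subseteq> TH p" using winding_in_TH by auto
      fix w assume "w \<in> winding ` U"
      then obtain x where x: "x \<in> U" "w = winding x" by blast
      then obtain r where r: "r > 0" "L.mball x r \<subseteq> U"
        using U by (auto simp: L.openin_mtopology)
      have "T.mball w r \<subseteq> winding ` U"
      proof
        fix z assume z: "z \<in> T.mball w r"
        obtain y where "y \<in> lp p" "winding y = z"
          "seq_dist_on (lp p) p x y \<le> seq_dist_on (TH p) p (winding x) z"
          using winding_lift[of x z] x(1) \<open>U \<subseteq> lp p\<close> z by auto
        moreover from this have "y \<in> L.mball x r" using z x \<open>U \<subseteq> lp p\<close> by auto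
        ultimately show "z \<in> winding ` U" using r by blast
      qed
      then show "\<exists>r>0. T.mball w r \<subseteq> winding ` U" using r(1) by blast
    qed
  qed
qed (simp add: winding_image)

section \<open>Kernel and the induced isomorphism\<close>

lemma group_hom_winding: "group_hom (lp_group p) (TH_group p) winding"
proof -
  interpret A: comm_group "lp_group p" by (rule comm_group_lp_group[OF p])
  show ?thesis
  proof unfold_locales
    show "winding \<in> hom (lp_group p) (TH_group p)"
      by (rule homI) (auto simp: lp_group_def TH_group_def winding_in_TH winding_def cis_mult distrib_left)
  qed
qed

lemma kernel_winding: "kernel (lp_group p) (TH_group p) winding = Z0"
proof -
  have "winding x = (\<lambda>n. 1) \<longleftrightarrow> x \<in> Z0" if x: "x \<in> lp p" for x
  proof -
    have "finite {n. x n \<noteq> 0}" if int: "\<And>n. x n \<in> \<int>"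
    proof -
      \<comment> \<open>A sequence in \<open>lp p\<close> tends to 0, and an integer of absolute
        value below 1 is 0.\<close>
      have "\<forall>\<^sub>F n in sequentially. \<bar>x n\<bar> < 1"
        using tendsto_rabs_zero[OF lp_imp_null[OF p x]] by (rule order_tendstoD) simp
      then have "\<forall>\<^sub>F n in sequentially. x n = 0"
        by eventually_elim (use int Ints_nonzero_abs_less1 in blast)
      then show ?thesis
        by (simp add: eventually_cofinite flip: cofinite_eq_sequentially)
    qed
    then show ?thesis by (auto simp: fun_eq_iff winding_def cis_2pi_eq_1_iff Z0_def)
  qed
  then show ?thesis
    using Z0_subset_lp by (auto simp: kernel_def lp_group_def TH_group_def)
qed

text \<open>\<open>winding\<close> and the coset map are quotient maps on the same space with the
  same fibres, so the bijection of the first isomorphism theorem is a homeomorphism. It leads from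
  the quotient to the torus and is inverted at the end.\<close>

lemma topologically_isomorphic_TH:
  "topologically_isomorphic (TH_group p) (TH_topology p) (lp_mod_Z0_group p) (lp_mod_Z0_topology p)"
proof -
  interpret W: group_hom "lp_group p" "TH_group p" winding by (rule group_hom_winding)
  interpret N: normal Z0 "lp_group p" by (rule normal_Z0[OF p])
  let ?Q = "lp_mod_Z0_topology p"
  let ?q = "\<lambda>x. Z0 #>\<^bsub>lp_group p\<^esub> x"
  \<comment> \<open>\<open>winding\<close> is constant on each coset, and \<open>the_elem\<close>
    extracts its single value.\<close>
  define h where "h = (\<lambda>S. the_elem (winding ` S))"
  have h_iso: "h \<in> iso (lp_mod_Z0_group p) (TH_group p)"
    unfolding h_def lp_mod_Z0_group_def kernel_winding[symmetric]
    by (rule W.FactGroup_iso_set) (simp add: winding_image lp_group_def TH_group_def)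
  have q: "quotient_map L.mtopology ?Q ?q"
    using quotient_map_quotient_topology[of "lp_topology p" ?q]
    by (simp add: lp_mod_Z0_topology_def lp_topology_eq)
  have "winding ` (?q x) = {winding x}" if x: "x \<in> lp p" for x
  proof -
    have "winding y = winding x" if "y \<in> ?q x" for y
    proof -
      from that obtain k where k: "k \<in> Z0" "y = (\<lambda>n. k n + x n)"
        by (auto simp: r_coset_def lp_group_def)
      then have "winding k = (\<lambda>n. 1)"
        using kernel_winding by (auto simp: kernel_def TH_group_def)
      then show ?thesis using k
        by (auto simp: winding_def fun_eq_iff distrib_left simp flip: cis_mult)
    qed
    moreover have "x \<in> ?q x"
    proof -
      have "(\<lambda>n. 0) \<in> Z0" by (simp add: Z0_def)
      then show ?thesis
        unfolding r_coset_def UN_iff by (rule bexI[rotated]) (simp add: lp_group_def)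
    qed
    ultimately show ?thesis by blast
  qed
  then have hq: "winding x = (h \<circ> ?q) x" if "x \<in> lp p" for x
    using that by (simp add: h_def)
  \<comment> \<open>On \<open>lp p\<close> this composition agrees with \<open>winding\<close>;
    cancelling the quotient map \<open>?q\<close> leaves \<open>h\<close> as a quotient map.\<close>
  have "quotient_map L.mtopology T.mtopology (h \<circ> ?q)"
    by (rule quotient_map_eq[OF quotient_map_winding]) (use hq in simp)
  then have "quotient_map ?Q T.mtopology h"
    using quotient_map_compose_eq[OF q] by blast
  moreover have carrier: "topspace ?Q = carrier (lp_mod_Z0_group p)"
    using quotient_imp_surjective_map[OF q]
    by (auto simp: lp_mod_Z0_group_def FactGroup_def RCOSETS_def lp_group_def)
  moreover have inj: "inj_on h (carrier (lp_mod_Z0_group p))"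
    using h_iso by (simp add: iso_def bij_betw_def)
  ultimately have "homeomorphic_map ?Q T.mtopology h" by (simp add: homeomorphic_map_def)
  then obtain h' where h': "homeomorphic_maps ?Q T.mtopology h h'"
    by (auto simp: homeomorphic_map_maps)
  \<comment> \<open>The algebraic inverse \<open>?f\<close> and the topological inverse
    \<open>h'\<close> agree on \<open>TH p\<close>, so one map is both an isomorphism and a
    homeomorphism.\<close>
  let ?f = "inv_into (carrier (lp_mod_Z0_group p)) h"
  have f_eq: "h' z = ?f z" if "z \<in> TH p" for z
  proof (rule inv_into_f_eq[OF inj, symmetric])
    have "h' \<in> topspace T.mtopology \<rightarrow> topspace ?Q" "\<forall>y\<in>topspace T.mtopology. h (h' y) = y"
      using h' unfolding homeomorphic_maps_def continuous_map_def by blast+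
    then show "h' z \<in> carrier (lp_mod_Z0_group p)" "h (h' z) = z"
      using that carrier by auto
  qed
  have "homeomorphic_map T.mtopology ?Q h'"
    using h' unfolding homeomorphic_maps_map by blast
  then have "homeomorphic_map T.mtopology ?Q ?f"
    by (rule homeomorphic_map_eq) (simp add: f_eq)
  moreover have "?f \<in> iso (TH_group p) (lp_mod_Z0_group p)"
    using group.iso_set_sym[OF _ h_iso] N.factorgroup_is_group by (simp add: lp_mod_Z0_group_def)
  ultimately show ?thesis
    by (auto simp: topologically_isomorphic_def TH_topology_eq)
qed

end

theorem proposition4:
  fixes p :: real
  assumes "0 \<le> p"
  shows "monothetic_group (TH_group p) (TH_topology p) \<and>
         polish_group (TH_group p) (TH_topology p) \<and>
         topologically_isomorphic (TH_group p) (TH_topology p)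
           (lp_mod_Z0_group p) (lp_mod_Z0_topology p)"
proof -
  interpret nonneg_exponent p by unfold_locales (rule assms)
  show ?thesis
    using monothetic_group_TH polish_group_TH topologically_isomorphic_TH by blast
qed

end
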